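(* Let $0<M=CC^*\in\mathbb C^{n\times n}$ (Cholesky decomposition), $0<D=D^*\in\mathbb C^{n\times n}$, let $G\in\mathbb C^{n\times r}$ have rank $r\ge1$, and suppose that $P(\lambda):=\lambda^2M+\lambda D+GG^*$ is hyperbolic. Define $$\mathcal A:=\begin{bmatrix} -C^{-1}D(C^{-1})^* & -C^{-1}G \\ (C^{-1}G)^* & 0 \end{bmatrix},\qquad J:=\begin{bmatrix} -I_n & 0 \\ 0 & I_r \end{bmatrix},\qquad S(\lambda):=\begin{bmatrix} \lambda M+D & G \\ G^* & -\lambda I_r \end{bmatrix}.$$ Then the following assertions hold. (a) The spectrum of $\mathcal A$ consists of $n$ (counting multiplicity) $J$-negative and $r$ (counting multiplicity) $J$-positive eigenvalues. (b) Let $\Lambda^+(\mathcal A)$ and $\Lambda^-(\mathcal A)$ denote the sets of $J$-positive and $J$-negative eigenvalues of $\mathcal A$, respectively. Then there exists $\alpha\in\mathbb R$ such that $\Lambda^-(\mathcal A)<\alpha<\Lambda^+(\mathcal A)$. (c) Let $\lambda^+_{\min}$ be the smallest eigenvalue in $\Lambda^+(\mathcal A)$ and $\lambda^-_{\max}$ the largest eigenvalue in $\Lambda^-(\mathcal A)$. Then $(\lambda^-_{\max},\lambda^+_{\min})$ is the definitizing interval for $\mathcal A$ in the sense that for each $\mu\in(\lambda^-_{\max},\lambda^+_{\min})$ the matrix $J\mathcal A-\mu J$ is positive definite. (d) For each $\mu\in(\lambda^-_{\max},\lambda^+_{\min})$ we have $\mu<0$, $S(\mu)>0$ and $-P(\mu)>0$.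 (e) Suppose that $\mu\in\mathbb R$ is not an eigenvalue of $\mathcal A$. If $\mu>\lambda^+_{\min}$, then $$\imath_+(J\mathcal A-\mu J)=\#\{\lambda\in\Lambda^+(\mathcal A):\lambda>\mu\}+n,\qquad \imath_-(J\mathcal A-\mu J)=\#\{\lambda\in\Lambda^+(\mathcal A):\lambda<\mu\}.$$ If $\mu<\lambda^-_{\max}$, then $$\imath_+(J\mathcal A-\mu J)=\#\{\lambda\in\Lambda^-(\mathcal A):\lambda<\mu\}+r,\qquad \imath_-(J\mathcal A-\mu J)=\#\{\lambda\in\Lambda^-(\mathcal A):\lambda>\mu\}.$$ Here $\#$ counts eigenvalues with multiplicity.
   Context: $A^*$ denotes the conjugate transpose; for Hermitian matrices $X>0$ means positive definite. For a Hermitian matrix $H$, $\imath_+(H)$ and $\imath_-(H)$ are the numbers of positive and negative eigenvalues of $H$, counted with multiplicity. A quadratic matrix polynomial $P(\lambda)=\lambda^2M+\lambda D+K$ with Hermitian coefficients is called hyperbolic if $M>0$ and $(x^*Dx)^2-4(x^*Mx)(x^*Kx)>0$ for all nonzero $x\in\mathbb C^n$ or, equivalently (a known fact), if $M>0$ and $-P(\mu)>0$ for some $\mu\in\mathbb R$. The matrix $\mathcal A$ is $J$-Hermitian, i.e. $(J\mathcal A)^*=J\mathcal A$. A real eigenvalue $\lambda$ of $\mathcal A$ is called $J$-positive (resp. $J$-negative) if $u^*Ju>0$ (resp. $u^*Ju<0$) for every nonzero $u$ in the spectral subspace $\mathcal N\big((\mathcal A-\lambda I_{n+r})^{n+r}\big)$,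 where $\mathcal N$ denotes the nullspace. For finite sets $\Lambda_1,\Lambda_2\subset\mathbb R$ and $\alpha\in\mathbb R$, $\Lambda_1<\alpha<\Lambda_2$ means $\max\Lambda_1<\alpha<\min\Lambda_2$. *)

theory Defs
  imports
    "Jordan_Normal_Form.Schur_Decomposition"
    "Jordan_Normal_Form.Gauss_Jordan_Elimination"
    "Jordan_Normal_Form.Matrix_Kernel"
    "Jordan_Normal_Form.Spectral_Radius"
    "Jordan_Normal_Form.DL_Rank"
begin

lemma mat_adjoint_carrier: "A \<in> carrier_mat m n \<Longrightarrow> mat_adjoint A \<in> carrier_mat n m"
  by (auto simp: mat_adjoint_def)

lemma mat_adjoint_index:
  "i < dim_col A \<Longrightarrow> j < dim_row A \<Longrightarrow> mat_adjoint A $$ (i, j) = conjugate (A $$ (j, i))"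
  by (simp add: mat_adjoint_def mat_of_rows_index)

(* Squareness is implied: the dimensions of mat_adjoint A are swapped. *)
definition hermitian_mat :: "complex mat \<Rightarrow> bool" where
  "hermitian_mat A \<longleftrightarrow> mat_adjoint A = A"

definition qform :: "complex mat \<Rightarrow> complex vec \<Rightarrow> complex" where
  "qform A x = conjugate x \<bullet> (A *\<^sub>v x)"

(* The order on complex is that of HOL-Library.Complex_Order: 0 < z means that z is real and
   positive. *)
definition pos_def_mat :: "complex mat \<Rightarrow> bool" where
  "pos_def_mat A \<longleftrightarrow> hermitian_mat A \<and>
     (\<forall>x\<in>carrier_vec (dim_row A). x \<noteq> 0\<^sub>v (dim_row A) \<longrightarrow> 0 < qform A x)"

(* Unspecified if A has no inverse. *)
definition mat_inv :: "complex mat \<Rightarrow> complex mat" where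
  "mat_inv A = the (mat_inverse A)"

lemma mat_inv:
  assumes "A \<in> carrier_mat n n" "B \<in> carrier_mat n n" "A * B = 1\<^sub>m n"
  shows "mat_inv A = B"
proof -
  have BA: "B * A = 1\<^sub>m n" using mat_mult_left_right_inverse assms by blast
  show ?thesis
  proof (cases "mat_inverse A")
    case None
    from mat_inverse(1)[OF assms(1) None] have "A \<notin> Units (ring_mat TYPE(complex) n ())" .
    then show ?thesis using assms BA by (auto simp: Units_def ring_mat_simps)
  next
    case (Some X)
    from mat_inverse(2)[OF assms(1) Some] have X: "X * A = 1\<^sub>m n" "X \<in> carrier_mat n n" by auto
    have "X = X * (A * B)" using X assms by simp
    also have "\<dots> = (X * A) * B" using X assms assoc_mult_mat[of X n n A n B n] by simp
    finally have "X = B" using X assms by simp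
    then show ?thesis using Some by (simp add: mat_inv_def)
  qed
qed

definition cholesky :: "complex mat \<Rightarrow> complex mat \<Rightarrow> bool" where
  "cholesky C M \<longleftrightarrow> square_mat C \<and>
     (\<forall>i<dim_row C. \<forall>j<dim_row C. i < j \<longrightarrow> C $$ (i, j) = 0) \<and>
     (\<forall>i<dim_row C. 0 < C $$ (i, i)) \<and>
     M = C * mat_adjoint C"

definition quad_matpoly ::
  "complex mat \<Rightarrow> complex mat \<Rightarrow> complex mat \<Rightarrow> complex \<Rightarrow> complex mat" where
  "quad_matpoly M D K z = z\<^sup>2 \<cdot>\<^sub>m M + z \<cdot>\<^sub>m D + K"

(* Hyperbolicity of quad_matpoly M D K, as a property of its coefficients. *)
definition hyperbolic_quad :: "complex mat \<Rightarrow> complex mat \<Rightarrow> complex mat \<Rightarrow> bool" where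
  "hyperbolic_quad M D K \<longleftrightarrow>
     hermitian_mat D \<and> hermitian_mat K \<and> pos_def_mat M \<and>
     (\<forall>x\<in>carrier_vec (dim_row M). x \<noteq> 0\<^sub>v (dim_row M) \<longrightarrow>
        0 < (qform D x)\<^sup>2 - 4 * qform M x * qform K x)"

definition spectral_subspace :: "complex mat \<Rightarrow> complex \<Rightarrow> complex vec set" where
  "spectral_subspace A z = mat_kernel ((A - z \<cdot>\<^sub>m 1\<^sub>m (dim_row A)) ^\<^sub>m dim_row A)"

definition J_positive_eigenvalues :: "complex mat \<Rightarrow> complex mat \<Rightarrow> real set" where
  "J_positive_eigenvalues J A = {x. eigenvalue A (complex_of_real x) \<and>
     (\<forall>u\<in>spectral_subspace A (complex_of_real x). u \<noteq> 0\<^sub>v (dim_row A) \<longrightarrow> 0 < qform J u)}"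

definition J_negative_eigenvalues :: "complex mat \<Rightarrow> complex mat \<Rightarrow> real set" where
  "J_negative_eigenvalues J A = {x. eigenvalue A (complex_of_real x) \<and>
     (\<forall>u\<in>spectral_subspace A (complex_of_real x). u \<noteq> 0\<^sub>v (dim_row A) \<longrightarrow> qform J u < 0)}"

(* Polynomial.order is the multiplicity of a root; the qualifier avoids the order of a group. *)
definition alg_mult :: "complex mat \<Rightarrow> real \<Rightarrow> nat" where
  "alg_mult A x = Polynomial.order (complex_of_real x) (char_poly A)"

definition count_mult :: "complex mat \<Rightarrow> real set \<Rightarrow> nat" where
  "count_mult A \<Lambda> = (\<Sum>x\<in>\<Lambda>. alg_mult A x)"

(* Inertia of a Hermitian matrix: only real eigenvalues are counted. *)
definition pos_inertia :: "complex mat \<Rightarrow> nat" where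
  "pos_inertia H = count_mult H {x. eigenvalue H (complex_of_real x) \<and> 0 < x}"

definition neg_inertia :: "complex mat \<Rightarrow> nat" where
  "neg_inertia H = count_mult H {x. eigenvalue H (complex_of_real x) \<and> x < 0}"

end

theory Submission
  imports Defs "HOL-Analysis.Function_Topology"
begin

text \<open>
  Put $H(\mu) = J\mathcal A - \mu J$. The matrix $S(\mu)$ is congruent to $H(\mu)$, and for $\mu < 0$
  its Schur complement is $P(\mu)/\mu$; so $H(\mu) > 0$ is equivalent to $\mu < 0$ and $-P(\mu) > 0$.

  The roots $\lambda_\pm(x)$ of $x^*P(\lambda)x$ attain their extrema on the unit sphere. If
  $\max\lambda_- \ge \min\lambda_+$, then some $\mu$ is both a smaller root for a vector $x$ and a larger
  root for a vector $y$. On the span of $x$ and $y$ one finds a curve of zeros of the form $P(\mu)$ along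
  which $P'(\mu)$ changes sign, hence a vector with a double root, against hyperbolicity. So
  $-P(\alpha) > 0$ for every $\alpha$ between the extrema.

  For this $\alpha$ simultaneous diagonalization of $H(\alpha) > 0$ and $J$ gives an invertible $W$ with
  $W^{-1}\mathcal A W = \mathrm{diag}(\theta_i)$ and $W^*JW = \mathrm{diag}(1/(\theta_i - \alpha))$, so
  $W^*H(\mu)W = \mathrm{diag}((\theta_i - \mu)/(\theta_i - \alpha))$. Everything is then read off the signs
  of these entries by Sylvester's law of inertia.
\<close>

section \<open>Adjoints, quadratic forms and congruence\<close>

text \<open>Hyperbolicity constrains one vector at a time, whereas a point \<alpha> with
  -P(\<alpha>) > 0 has to serve all vectors at once; that passage is the only analytic step. It
  takes connectedness to order the roots of different vectors, along segments that must be kept away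
  from 0, and compactness, because attained extrema turn the ordering into a gap. Such an \<alpha>
  is automatically negative: with M > 0, D > 0 and a semidefinite constant term, the form of
  P(\<mu>) is nonnegative for every \<mu> \<ge> 0. The rest is algebra. Since J squares to the
  identity, J H(\<alpha>) = A - \<alpha> I. In a basis where H(\<alpha>) becomes the identity and J
  becomes diag(\<kappa>), the matrix of A - \<alpha> I is therefore the inverse of diag(\<kappa>),
  which explains \<theta> = \<alpha> + 1/\<kappa>. In particular A is diagonalizable with real
  spectrum, its spectral subspaces are eigenspaces, and the J-sign of an eigenvalue is the side of
  \<alpha> on which it lies.\<close>

lemma mat_adjoint_dim [simp]:
  "dim_row (mat_adjoint A) = dim_col A" "dim_col (mat_adjoint A) = dim_row A"
  by (auto simp: mat_adjoint_def)

lemma mat_diag_dims [simp]: "dim_row (mat_diag n f) = n" "dim_col (mat_diag n f) = n"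
  by (simp_all add: mat_diag_def)

lemma mat_adjoint_index_complex [simp]:
  fixes A :: "complex mat"
  shows "i < dim_col A \<Longrightarrow> j < dim_row A \<Longrightarrow> mat_adjoint A $$ (i, j) = cnj (A $$ (j, i))"
  by (simp add: mat_adjoint_index)

lemma mat_adjoint_adjoint [simp]: "mat_adjoint (mat_adjoint A) = (A :: complex mat)"
  by (rule eq_matI) auto

lemma mat_adjoint_mult:
  fixes A B :: "complex mat"
  assumes "A \<in> carrier_mat m n" "B \<in> carrier_mat n k"
  shows "mat_adjoint (A * B) = mat_adjoint B * mat_adjoint A"
  using assms by (intro eq_matI) (auto simp: scalar_prod_def mult.commute intro!: sum.cong)

lemma mat_adjoint_one [simp]: "mat_adjoint (1\<^sub>m n :: complex mat) = 1\<^sub>m n"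
  by (rule eq_matI) auto

lemma mat_adjoint_zero [simp]: "mat_adjoint (0\<^sub>m m n :: complex mat) = 0\<^sub>m n m"
  by (rule eq_matI) auto

lemma mat_adjoint_smult [simp]: "mat_adjoint (c \<cdot>\<^sub>m A) = cnj c \<cdot>\<^sub>m mat_adjoint (A :: complex mat)"
  by (rule eq_matI) auto

lemma mat_adjoint_add:
  fixes A B :: "complex mat"
  assumes "A \<in> carrier_mat m n" "B \<in> carrier_mat m n"
  shows "mat_adjoint (A + B) = mat_adjoint A + mat_adjoint B"
  using assms by (intro eq_matI) auto

lemma mat_adjoint_diag [simp]: "mat_adjoint (mat_diag n f) = mat_diag n (\<lambda>i. cnj (f i))"
  by (rule eq_matI) (auto simp: mat_diag_def)

lemma mat_adjoint_four_block:
  fixes A B C D :: "complex mat"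
  assumes "A \<in> carrier_mat n1 m1" "B \<in> carrier_mat n1 m2"
    and "C \<in> carrier_mat n2 m1" "D \<in> carrier_mat n2 m2"
  shows "mat_adjoint (four_block_mat A B C D) =
    four_block_mat (mat_adjoint A) (mat_adjoint C) (mat_adjoint B) (mat_adjoint D)"
  using assms by (intro eq_matI) auto

lemma scalar_prod_adjoint:
  fixes X :: "complex mat"
  assumes "X \<in> carrier_mat m n" "x \<in> carrier_vec n" "w \<in> carrier_vec m"
  shows "conjugate (X *\<^sub>v x) \<bullet> w = conjugate x \<bullet> (mat_adjoint X *\<^sub>v w)"
proof -
  have "conjugate (X *\<^sub>v x) \<bullet> w =
      (\<Sum>i = 0..<m. \<Sum>j = 0..<n. cnj (X $$ (i, j)) * cnj (x $ j) * w $ i)"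
    using assms by (simp add: scalar_prod_def sum_distrib_right)
  also have "\<dots> = (\<Sum>j = 0..<n. \<Sum>i = 0..<m. cnj (X $$ (i, j)) * cnj (x $ j) * w $ i)"
    by (rule sum.swap)
  also have "\<dots> = conjugate x \<bullet> (mat_adjoint X *\<^sub>v w)"
    using assms by (simp add: scalar_prod_def sum_distrib_left mult_ac)
  finally show ?thesis .
qed

lemma qform_congruence:
  assumes "N \<in> carrier_mat m m" "X \<in> carrier_mat m n" "x \<in> carrier_vec n"
  shows "qform (mat_adjoint X * N * X) x = qform N (X *\<^sub>v x)"
proof -
  have "mat_adjoint X * N * X *\<^sub>v x = mat_adjoint X *\<^sub>v (N *\<^sub>v (X *\<^sub>v x))"
    using assms mat_adjoint_carrier[OF assms(2)]
    by (simp add: assoc_mult_mat_vec[of _ n m _ n] assoc_mult_mat_vec[of _ n m _ m])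
  then show ?thesis
    using scalar_prod_adjoint[OF assms(2,3), of "N *\<^sub>v (X *\<^sub>v x)"] assms by (simp add: qform_def)
qed

lemma hermitian_congruence:
  assumes "hermitian_mat N" "N \<in> carrier_mat m m" "X \<in> carrier_mat m n"
  shows "hermitian_mat (mat_adjoint X * N * X)"
proof -
  have X: "mat_adjoint X \<in> carrier_mat n m" using assms mat_adjoint_carrier by blast
  have "mat_adjoint (mat_adjoint X * N * X) = mat_adjoint X * (mat_adjoint N * X)"
    using assms X mat_adjoint_mult[of "mat_adjoint X * N" n m X n] mat_adjoint_mult[OF X, of N m]
    by simp
  then show ?thesis using assms X by (simp add: hermitian_mat_def)
qed

lemma qform_hermitian_real:
  assumes "hermitian_mat N" "N \<in> carrier_mat n n" "x \<in> carrier_vec n"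
  shows "Im (qform N x) = 0"
proof -
  have "cnj (qform N x) = conjugate (conjugate x \<bullet> (N *\<^sub>v x))"
    by (simp add: qform_def)
  also have "\<dots> = x \<bullet> conjugate (N *\<^sub>v x)"
    using assms by (subst conjugate_sprod_vec[of _ n]) auto
  also have "\<dots> = conjugate (N *\<^sub>v x) \<bullet> x"
    using assms by (intro comm_scalar_prod[of _ n]) auto
  also have "\<dots> = qform N x"
    using scalar_prod_adjoint[OF assms(2,3,3)] assms(1) by (simp add: qform_def hermitian_mat_def)
  finally have "Im (cnj (qform N x)) = Im (qform N x)" by simp
  then show ?thesis by simp
qed

lemma mat_diag_mult_vec:
  assumes "c \<in> carrier_vec n"
  shows "mat_diag n f *\<^sub>v c = vec n (\<lambda>i. f i * c $ i :: complex)"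
proof (rule eq_vecI)
  fix i assume "i < dim_vec (vec n (\<lambda>i. f i * c $ i))"
  then have i: "i < n" by simp
  then have "(mat_diag n f *\<^sub>v c) $ i = (\<Sum>j = 0..<n. (if i = j then f j else 0) * c $ j)"
    using assms by (simp add: mat_diag_def scalar_prod_def)
  also have "\<dots> = (\<Sum>j = 0..<n. if i = j then f j * c $ j else 0)"
    by (rule sum.cong) auto
  finally show "(mat_diag n f *\<^sub>v c) $ i = vec n (\<lambda>i. f i * c $ i) $ i" using i by simp
qed simp

lemma qform_diag:
  assumes "x \<in> carrier_vec n"
  shows "qform (mat_diag n f) x = (\<Sum>i<n. f i * of_real ((cmod (x $ i))\<^sup>2))"
  unfolding qform_def mat_diag_mult_vec[OF assms] using assms
  by (auto simp: scalar_prod_def lessThan_atLeast0 complex_norm_square mult_ac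
      intro!: sum.cong simp del: of_real_power)

lemma qform_smult_mat:
  assumes "N \<in> carrier_mat n n" "x \<in> carrier_vec n"
  shows "qform (c \<cdot>\<^sub>m N) x = c * qform N x"
proof -
  have "(c \<cdot>\<^sub>m N) *\<^sub>v x = c \<cdot>\<^sub>v (N *\<^sub>v x)"
    using assms by (intro eq_vecI) auto
  then show ?thesis using assms by (simp add: qform_def)
qed

lemma qform_add_mat:
  assumes "A \<in> carrier_mat n n" "B \<in> carrier_mat n n" "x \<in> carrier_vec n"
  shows "qform (A + B) x = qform A x + qform B x"
  using assms by (simp add: qform_def add_mult_distrib_mat_vec[of _ n n] scalar_prod_add_distrib[of _ n])

lemma invertible_mult_vec_nonzero:
  fixes X Y :: "complex mat"
  assumes "X \<in> carrier_mat n n" "Y \<in> carrier_mat n n" "Y * X = 1\<^sub>m n"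
    and "x \<in> carrier_vec n" "x \<noteq> 0\<^sub>v n"
  shows "X *\<^sub>v x \<noteq> 0\<^sub>v n"
proof
  assume "X *\<^sub>v x = 0\<^sub>v n"
  then have "Y * X *\<^sub>v x = 0\<^sub>v n" using assms(1,2,4)
    by (simp add: assoc_mult_mat_vec[of _ n n]) (auto simp: mult_mat_vec_def scalar_prod_def)
  then show False using assms by simp
qed

lemma pos_def_congruence:
  assumes "pos_def_mat N" "N \<in> carrier_mat n n"
    and "X \<in> carrier_mat n n" "Y \<in> carrier_mat n n" "Y * X = 1\<^sub>m n"
  shows "pos_def_mat (mat_adjoint X * N * X)"
  unfolding pos_def_mat_def
proof safe
  show "hermitian_mat (mat_adjoint X * N * X)"
    using assms hermitian_congruence pos_def_mat_def by blast
  fix x :: "complex vec"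
  assume "x \<in> carrier_vec (dim_row (mat_adjoint X * N * X))"
    "x \<noteq> 0\<^sub>v (dim_row (mat_adjoint X * N * X))"
  then have x: "x \<in> carrier_vec n" "x \<noteq> 0\<^sub>v n" using assms by auto
  from invertible_mult_vec_nonzero[OF assms(3,4,5) x] x assms
  show "0 < qform (mat_adjoint X * N * X) x"
    unfolding qform_congruence[OF assms(2,3) x(1)] by (auto simp: pos_def_mat_def)
qed

lemma congruence_inverse:
  fixes N X Y :: "complex mat"
  assumes "N \<in> carrier_mat n n" "X \<in> carrier_mat n n" "Y \<in> carrier_mat n n" "X * Y = 1\<^sub>m n"
  shows "mat_adjoint Y * (mat_adjoint X * N * X) * Y = N"
proof -
  note adj = mat_adjoint_carrier[OF assms(2)] mat_adjoint_carrier[OF assms(3)]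
  have "mat_adjoint Y * mat_adjoint X = 1\<^sub>m n"
    using mat_adjoint_mult[OF assms(2,3)] assms(4) by simp
  moreover have "mat_adjoint Y * (mat_adjoint X * N * X) * Y =
      (mat_adjoint Y * mat_adjoint X) * N * (X * Y)"
    using assms(1-3) adj by (simp add: assoc_mult_mat[of _ n n _ n _ n])
  ultimately show ?thesis using assms by simp
qed

lemma pos_def_congruence_iff:
  assumes "N \<in> carrier_mat n n" "X \<in> carrier_mat n n" "Y \<in> carrier_mat n n" "Y * X = 1\<^sub>m n"
  shows "pos_def_mat (mat_adjoint X * N * X) \<longleftrightarrow> pos_def_mat N"
proof
  assume *: "pos_def_mat (mat_adjoint X * N * X)"
  have XY: "X * Y = 1\<^sub>m n" using assms mat_mult_left_right_inverse by blast
  have "mat_adjoint X * N * X \<in> carrier_mat n n" using assms mat_adjoint_carrier by auto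
  from pos_def_congruence[OF * this assms(3,2) XY]
  show "pos_def_mat N" using congruence_inverse[OF assms(1-3) XY] by simp
qed (use assms pos_def_congruence in blast)

lemma pos_def_diag_iff:
  "pos_def_mat (mat_diag n f) \<longleftrightarrow> (\<forall>i<n. 0 < f i)"
proof
  assume pd: "pos_def_mat (mat_diag n f)"
  show "\<forall>i<n. 0 < f i"
  proof safe
    fix i assume i: "i < n"
    have "unit_vec n i \<in> carrier_vec n" "unit_vec n i \<noteq> (0\<^sub>v n :: complex vec)"
      using i by auto
    with pd have "0 < qform (mat_diag n f) (unit_vec n i)"
      by (auto simp: pos_def_mat_def mat_diag_def)
    also have "qform (mat_diag n f) (unit_vec n i) = (\<Sum>j<n. if j = i then f j else 0)"
      unfolding qform_diag[OF unit_vec_carrier] using i by (intro sum.cong) auto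
    finally show "0 < f i" using i by simp
  qed
next
  assume pos: "\<forall>i<n. 0 < f i"
  then have re: "cnj (f i) = f i" if "i < n" for i
    using that by (simp add: complex_eq_iff less_complex_def)
  then have "hermitian_mat (mat_diag n f)"
    by (auto simp: hermitian_mat_def) (auto simp: mat_diag_def intro!: eq_matI)
  moreover have "0 < qform (mat_diag n f) x" if x: "x \<in> carrier_vec n" "x \<noteq> 0\<^sub>v n" for x
  proof -
    from x obtain i where i: "i < n" "x $ i \<noteq> 0" by (metis eq_vecI carrier_vecD index_zero_vec)
    have "0 < (\<Sum>j<n. f j * of_real ((cmod (x $ j))\<^sup>2))"
    proof (rule sum_pos2[of _ i])
      show "0 < f i * of_real ((cmod (x $ i))\<^sup>2)"
        using pos i by (auto simp: less_complex_def)
      show "0 \<le> f j * of_real ((cmod (x $ j))\<^sup>2)" if "j \<in> {..<n}" for j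
        using pos that by (auto simp: less_complex_def less_eq_complex_def intro!: mult_nonneg_nonneg
            intro: less_imp_le)
    qed (use i in auto)
    then show ?thesis using qform_diag[OF x(1)] by simp
  qed
  ultimately show "pos_def_mat (mat_diag n f)"
    by (auto simp: pos_def_mat_def mat_diag_def)
qed

section \<open>The spectral theorem and the law of inertia\<close>

text \<open>Fewer than \<open>n\<close> linear conditions leave a nonzero solution: padded with zero
  rows they form a singular square matrix. The product is taken without conjugation, so that
  \<open>row Z i \<bullet> v = 0\<close> literally says that coordinate \<open>i\<close> of
  \<open>Z v\<close> vanishes.\<close>

lemma ex_orthogonal_vec:
  fixes rs :: "'a :: field vec list"
  assumes "length rs < n"
  shows "\<exists>v\<in>carrier_vec n. v \<noteq> 0\<^sub>v n \<and> (\<forall>r\<in>set rs. r \<in> carrier_vec n \<longrightarrow> r \<bullet> v = 0)"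
proof -
  define A where "A = mat n n (\<lambda>(i, j). if i < length rs then rs ! i $ j else 0)"
  have A: "A \<in> carrier_mat n n" by (simp add: A_def)
  let ?k = "length rs"
  \<comment> \<open>Row \<open>length rs\<close> of \<open>A\<close> is the first padding row, so
    the corresponding column of the transpose is zero.\<close>
  have "transpose_mat A *\<^sub>v unit_vec n ?k = 0\<^sub>v n"
    using assms by (intro eq_vecI) (auto simp: A_def)
  moreover have "unit_vec n ?k \<noteq> (0\<^sub>v n :: 'a vec)" using assms by simp
  moreover have "transpose_mat A \<in> carrier_mat n n" using A by simp
  ultimately have "det (transpose_mat A) = 0"
    using det_0_iff_vec_prod_zero[of "transpose_mat A" n] unit_vec_carrier[of n ?k] by metis
  then have "det A = 0" using det_transpose[OF A] by simp
  then obtain v where v: "v \<in> carrier_vec n" "v \<noteq> 0\<^sub>v n" "A *\<^sub>v v = 0\<^sub>v n"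
    using det_0_iff_vec_prod_zero[OF A] by auto
  have "r \<bullet> v = 0" if "r \<in> set rs" "r \<in> carrier_vec n" for r
  proof -
    from that obtain i where i: "i < ?k" "r = rs ! i" by (auto simp: in_set_conv_nth)
    have "row A i = r" using i that assms by (intro eq_vecI) (auto simp: A_def)
    moreover have "(A *\<^sub>v v) $ i = row A i \<bullet> v" using i assms A by auto
    ultimately show ?thesis using v(3) i assms by simp
  qed
  with v show ?thesis by blast
qed

text \<open>If there were more positive \<open>e i\<close> than positive \<open>d i\<close>, some nonzero \<open>v\<close> would be supported on the
  positive \<open>e i\<close> while \<open>Z v\<close> vanishes on the positive \<open>d i\<close>: too few linear conditions.\<close>

lemma card_positive_congruent_le:
  fixes d e :: "nat \<Rightarrow> real" and Z :: "complex mat"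
  assumes Z: "Z \<in> carrier_mat n n"
    and eq: "mat_adjoint Z * mat_diag n (\<lambda>i. of_real (d i)) * Z = mat_diag n (\<lambda>i. of_real (e i))"
  shows "card {i\<in>{..<n}. 0 < e i} \<le> card {i\<in>{..<n}. 0 < d i}"
proof (rule ccontr)
  assume less: "\<not> ?thesis"
  define I1 where "I1 = {i\<in>{..<n}. \<not> 0 < e i}"
  define I2 where "I2 = {i\<in>{..<n}. 0 < d i}"
  have fin: "finite I1" "finite I2" by (simp_all add: I1_def I2_def)
  define rs where "rs = map (unit_vec n) (sorted_list_of_set I1) @ map (row Z) (sorted_list_of_set I2)"
  have "card {i\<in>{..<n}. 0 < e i} + card I1 = card ({i\<in>{..<n}. 0 < e i} \<union> I1)"
    by (rule card_Un_disjoint[symmetric]) (auto simp: I1_def)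
  also have "{i\<in>{..<n}. 0 < e i} \<union> I1 = {..<n}" by (auto simp: I1_def)
  finally have "card {i\<in>{..<n}. 0 < e i} + card I1 = n" by simp
  with less have "length rs < n" by (simp add: rs_def I2_def)
  from ex_orthogonal_vec[OF this] obtain v where v: "v \<in> carrier_vec n" "v \<noteq> 0\<^sub>v n"
    and orth: "\<forall>r\<in>set rs. r \<in> carrier_vec n \<longrightarrow> r \<bullet> v = 0" by blast
  have v0: "v $ i = 0" if "i \<in> I1" for i
  proof -
    have "unit_vec n i \<bullet> v = 0" using orth that fin by (auto simp: rs_def)
    then show ?thesis using that v by (simp add: I1_def)
  qed
  have Zv0: "(Z *\<^sub>v v) $ i = 0" if "i \<in> I2" for i
  proof -
    have "row Z i \<bullet> v = 0" using orth that fin Z by (auto simp: rs_def)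
    then show ?thesis using that Z by (simp add: I2_def)
  qed
  have "qform (mat_diag n (\<lambda>i. of_real (e i))) v = qform (mat_diag n (\<lambda>i. of_real (d i))) (Z *\<^sub>v v)"
    using qform_congruence[OF mat_diag_dim Z v(1)] eq by metis
  then have "complex_of_real (\<Sum>i<n. e i * (cmod (v $ i))\<^sup>2) =
      of_real (\<Sum>i<n. d i * (cmod ((Z *\<^sub>v v) $ i))\<^sup>2)"
    using Z v by (simp add: qform_diag[of _ n])
  then have "(\<Sum>i<n. e i * (cmod (v $ i))\<^sup>2) = (\<Sum>i<n. d i * (cmod ((Z *\<^sub>v v) $ i))\<^sup>2)"
    by (simp only: of_real_eq_iff)
  also have "\<dots> \<le> 0"
  proof (rule sum_nonpos)
    fix i assume "i \<in> {..<n}"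
    then show "d i * (cmod ((Z *\<^sub>v v) $ i))\<^sup>2 \<le> 0"
      using Zv0[of i] by (cases "i \<in> I2") (auto simp: I2_def mult_nonpos_nonneg)
  qed
  finally have le: "(\<Sum>i<n. e i * (cmod (v $ i))\<^sup>2) \<le> 0" .
  from v obtain k where k: "k < n" "v $ k \<noteq> 0" by (metis eq_vecI carrier_vecD index_zero_vec)
  have "0 < (\<Sum>i<n. e i * (cmod (v $ i))\<^sup>2)"
  proof (rule sum_pos2[of _ k])
    have "0 < e k" using v0[of k] k by (auto simp: I1_def)
    then show "0 < e k * (cmod (v $ k))\<^sup>2" using k by simp
    show "0 \<le> e i * (cmod (v $ i))\<^sup>2" if "i \<in> {..<n}" for i
      using v0[of i] that by (cases "i \<in> I1") (auto simp: I1_def)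
  qed (use k in auto)
  with le show False by simp
qed

theorem sylvester_inertia_diag:
  fixes d e :: "nat \<Rightarrow> real" and Z Y :: "complex mat"
  assumes Z: "Z \<in> carrier_mat n n" "Y \<in> carrier_mat n n" "Z * Y = 1\<^sub>m n"
    and eq: "mat_adjoint Z * mat_diag n (\<lambda>i. of_real (d i)) * Z = mat_diag n (\<lambda>i. of_real (e i))"
  shows "card {i\<in>{..<n}. 0 < e i} = card {i\<in>{..<n}. 0 < d i}"
    and "card {i\<in>{..<n}. e i < 0} = card {i\<in>{..<n}. d i < 0}"
proof -
  have eq': "mat_adjoint Y * mat_diag n (\<lambda>i. of_real (e i)) * Y = mat_diag n (\<lambda>i. of_real (d i))"
    using congruence_inverse[OF mat_diag_dim Z] eq by metis
  \<comment> \<open>Negating both diagonals turns the count of negative entries into a count of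
    positive ones; the congruence survives.\<close>
  have neg: "mat_diag n (\<lambda>i. of_real (- f i) :: complex) = - mat_diag n (\<lambda>i. of_real (f i))" for f
    by (rule eq_matI) (auto simp: mat_diag_def)
  have neg_cong: "mat_adjoint X * (- N) * X = - (mat_adjoint X * N * X)"
    if "X \<in> carrier_mat n n" "N \<in> carrier_mat n n" for X N :: "complex mat"
    using that mat_adjoint_carrier[OF that(1)] by simp
  show "card {i\<in>{..<n}. 0 < e i} = card {i\<in>{..<n}. 0 < d i}"
    using card_positive_congruent_le[OF Z(1) eq] card_positive_congruent_le[OF Z(2) eq'] by simp
  have "mat_adjoint Z * mat_diag n (\<lambda>i. of_real (- d i)) * Z = mat_diag n (\<lambda>i. of_real (- e i))"
    "mat_adjoint Y * mat_diag n (\<lambda>i. of_real (- e i)) * Y = mat_diag n (\<lambda>i. of_real (- d i))"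
    unfolding neg using eq eq' Z by (simp_all add: neg_cong)
  from card_positive_congruent_le[OF Z(1) this(1)] card_positive_congruent_le[OF Z(2) this(2)]
  show "card {i\<in>{..<n}. e i < 0} = card {i\<in>{..<n}. d i < 0}" by simp
qed

text \<open>The deflation step of the spectral theorem: an eigenvector placed in the first column of
  a unitary matrix splits off a block of size 1.\<close>

lemma ex_unitary_first_col:
  fixes v :: "complex vec"
  assumes v: "v \<in> carrier_vec n" "v \<noteq> 0\<^sub>v n"
  shows "\<exists>W c. W \<in> carrier_mat n n \<and> mat_adjoint W * W = 1\<^sub>m n \<and> col W 0 = c \<cdot>\<^sub>v v"
proof -
  interpret cof_vec_space n "TYPE(complex)" .
  define b where "b = basis_completion v"
  define ws where "ws = gram_schmidt n b"
  note bc = basis_completion[OF v, folded b_def]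
  from gram_schmidt_result[OF bc(2,4,5) refl, folded ws_def]
  have ws: "set ws \<subseteq> carrier_vec n" "corthogonal ws" "length ws = n" by (auto simp: bc)
  have n: "0 < n" using v by (cases n) auto
  then obtain vs where "b = v # vs" using bc(6,7) by (cases b) auto
  then have "hd ws = v" using gram_schmidt_hd[OF v(1)] ws_def by auto
  \<comment> \<open>Gram-Schmidt leaves the head of the list unchanged, so after normalization the
    first column is still a multiple of \<open>v\<close>.\<close>
  then have ws0: "ws ! 0 = v" using ws(3) n by (simp add: hd_conv_nth[symmetric] length_0_conv[symmetric])
  have wsi: "ws ! i \<in> carrier_vec n" "ws ! i \<noteq> 0\<^sub>v n" if "i < n" for i
    using ws that corthogonalD[OF ws(2), of i i] by auto
  \<comment> \<open>Gram-Schmidt delivers orthogonal vectors only; dividing each by its norm makes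
    the columns orthonormal.\<close>
  define N where "N i = sqrt (Re (ws ! i \<bullet>c ws ! i))" for i
  have N: "0 < N i" "complex_of_real (N i * N i) = ws ! i \<bullet>c ws ! i" if "i < n" for i
    using conjugate_square_greater_0_vec[OF wsi(1)[OF that]] wsi(2)[OF that]
    by (auto simp: N_def less_complex_def complex_eq_iff)
  define W where "W = mat n n (\<lambda>(i, j). of_real (1 / N j) * ws ! j $ i)"
  have W: "W \<in> carrier_mat n n" by (simp add: W_def)
  have "mat_adjoint W * W = 1\<^sub>m n"
  proof (rule eq_matI)
    fix i j assume ij: "i < dim_row (1\<^sub>m n)" "j < dim_col (1\<^sub>m n)"
    then have ij: "i < n" "j < n" by simp_all
    have "(mat_adjoint W * W) $$ (i, j) =
        (\<Sum>k = 0..<n. of_real (1 / (N i * N j)) * (ws ! j $ k * cnj (ws ! i $ k)))"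
      using ij W by (auto simp: scalar_prod_def W_def intro!: sum.cong)
    also have "\<dots> = of_real (1 / (N i * N j)) * (ws ! j \<bullet>c ws ! i)"
      using wsi(1)[OF ij(1)] wsi(1)[OF ij(2)] by (simp add: scalar_prod_def sum_distrib_left)
    also have "\<dots> = (if i = j then 1 else 0)"
      using N[OF ij(1)] corthogonalD[OF ws(2), of j i] ij ws(3)
      by (auto simp del: of_real_mult simp flip: N(2))
    finally show "(mat_adjoint W * W) $$ (i, j) = 1\<^sub>m n $$ (i, j)" using ij by simp
  qed (use W in auto)
  moreover have "col W 0 = of_real (1 / N 0) \<cdot>\<^sub>v v"
    using v n by (intro eq_vecI) (auto simp: W_def ws0)
  ultimately show ?thesis using W by blast
qed

text \<open>With an eigenvector in the first column of \<open>W\<close>, the first column of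
  \<open>B\<close> is \<open>e\<close> times a unit vector. \<open>B\<close> is again Hermitian, so
  its first row vanishes off the diagonal as well and \<open>e\<close> is real; the induction
  hypothesis handles the remaining block.\<close>

theorem hermitian_diagonalization:
  assumes "H \<in> carrier_mat n n" "hermitian_mat H"
  shows "\<exists>U b. U \<in> carrier_mat n n \<and> mat_adjoint U * U = 1\<^sub>m n \<and>
    mat_adjoint U * H * U = mat_diag n (\<lambda>i. complex_of_real (b i))"
  using assms
proof (induction n arbitrary: H)
  case 0
  show ?case
    by (rule exI[of _ H], rule exI[of _ "\<lambda>_. 0"]) (use 0 in \<open>auto intro!: eq_matI\<close>)
next
  case (Suc m)
  note H = Suc.prems
  obtain e v where "eigenvector H v e"
    using spectrum_non_empty[OF H(1)] by (auto simp: spectrum_def eigenvalue_def)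
  then have v: "v \<in> carrier_vec (Suc m)" "v \<noteq> 0\<^sub>v (Suc m)" "H *\<^sub>v v = e \<cdot>\<^sub>v v"
    using H by (auto simp: eigenvector_def)
  from ex_unitary_first_col[OF v(1,2)] obtain W c where W: "W \<in> carrier_mat (Suc m) (Suc m)"
    and WW: "mat_adjoint W * W = 1\<^sub>m (Suc m)" and col: "col W 0 = c \<cdot>\<^sub>v v" by blast
  note W' = mat_adjoint_carrier[OF W]
  define B where "B = mat_adjoint W * H * W"
  have B: "B \<in> carrier_mat (Suc m) (Suc m)" using W W' H by (simp add: B_def)
  have "hermitian_mat B" unfolding B_def using hermitian_congruence H W by blast
  then have Bsym: "B $$ (i, j) = cnj (B $$ (j, i))" if "i < Suc m" "j < Suc m" for i j
    using that B mat_adjoint_index_complex[of i B j] by (simp add: hermitian_mat_def)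
  have w: "col W 0 \<in> carrier_vec (Suc m)" using col_dim[of W 0] W by simp
  have "col B 0 = mat_adjoint W * H *\<^sub>v col W 0"
    unfolding B_def by (rule col_mult2[OF mult_carrier_mat[OF W' H(1)] W]) simp
  also have "\<dots> = mat_adjoint W *\<^sub>v (H *\<^sub>v col W 0)"
    by (rule assoc_mult_mat_vec[OF W' H(1) w])
  also have "H *\<^sub>v col W 0 = c \<cdot>\<^sub>v (H *\<^sub>v v)"
    unfolding col by (rule mult_mat_vec[OF H(1) v(1)])
  also have "\<dots> = e \<cdot>\<^sub>v col W 0"
    unfolding col v(3) smult_smult_assoc by (simp only: mult.commute)
  also have "mat_adjoint W *\<^sub>v (e \<cdot>\<^sub>v col W 0) = e \<cdot>\<^sub>v (mat_adjoint W *\<^sub>v col W 0)"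
    by (rule mult_mat_vec[OF W' w])
  also have "mat_adjoint W *\<^sub>v col W 0 = col (mat_adjoint W * W) 0"
    by (rule col_mult2[symmetric, OF W' W]) simp
  finally have col0: "col B 0 = e \<cdot>\<^sub>v unit_vec (Suc m) 0" using WW by simp
  have B0: "B $$ (i, 0) = (if i = 0 then e else 0)" if "i < Suc m" for i
    using arg_cong[OF col0, of "\<lambda>v. v $ i"] that B by auto
  have B0': "B $$ (0, i) = (if i = 0 then e else 0)" if "i < Suc m" for i
    using Bsym[of 0 i] B0[of i] B0[of 0] Bsym[of 0 0] that by auto
  have e: "e = of_real (Re e)"
    using Bsym[of 0 0] B0[of 0] by (simp add: complex_eq_iff)
  define B3 where "B3 = mat m m (\<lambda>(i, j). B $$ (Suc i, Suc j))"
  let ?E = "mat 1 1 (\<lambda>_. e)"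
  have B3: "B3 \<in> carrier_mat m m" by (simp add: B3_def)
  have Bblock: "B = four_block_mat ?E (0\<^sub>m 1 m) (0\<^sub>m m 1) B3"
    using B by (intro eq_matI) (auto simp: B3_def B0 B0')
  have "hermitian_mat B3"
  proof (unfold hermitian_mat_def, rule eq_matI)
    fix i j assume "i < dim_row B3" "j < dim_col B3"
    then show "mat_adjoint B3 $$ (i, j) = B3 $$ (i, j)"
      using Bsym[of "Suc i" "Suc j"] by (simp add: B3_def)
  qed (simp_all add: B3_def)
  from Suc.IH[OF B3 this] obtain U3 b3 where U3: "U3 \<in> carrier_mat m m"
    "mat_adjoint U3 * U3 = 1\<^sub>m m" "mat_adjoint U3 * B3 * U3 = mat_diag m (\<lambda>i. complex_of_real (b3 i))"
    by blast
  note U3' = mat_adjoint_carrier[OF U3(1)]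
  define F where "F = four_block_mat (1\<^sub>m 1) (0\<^sub>m 1 m) (0\<^sub>m m 1) U3"
  have F: "F \<in> carrier_mat (Suc m) (Suc m)"
    using four_block_carrier_mat[of "1\<^sub>m 1" 1 1 U3 m m] U3 by (simp add: F_def)
  note F' = mat_adjoint_carrier[OF F]
  have F'eq: "mat_adjoint F = four_block_mat (1\<^sub>m 1) (0\<^sub>m 1 m) (0\<^sub>m m 1) (mat_adjoint U3)"
    unfolding F_def
    using mat_adjoint_four_block[OF one_carrier_mat zero_carrier_mat zero_carrier_mat U3(1), of 1]
    by simp
  have "mat_adjoint F * F = four_block_mat (1\<^sub>m 1) (0\<^sub>m 1 m) (0\<^sub>m m 1) (1\<^sub>m m)"
    unfolding F'eq unfolding F_def
    using mult_four_block_mat[OF one_carrier_mat zero_carrier_mat zero_carrier_mat U3'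
        one_carrier_mat zero_carrier_mat zero_carrier_mat U3(1), of 1] U3(1,2) U3'
    by simp
  then have FF: "mat_adjoint F * F = 1\<^sub>m (Suc m)" by simp
  have E: "?E \<in> carrier_mat 1 1" by simp
  have UB: "mat_adjoint U3 * B3 \<in> carrier_mat m m" using U3' B3 by simp
  have "mat_adjoint F * B = four_block_mat ?E (0\<^sub>m 1 m) (0\<^sub>m m 1) (mat_adjoint U3 * B3)"
    unfolding F'eq unfolding Bblock
    using mult_four_block_mat[OF one_carrier_mat zero_carrier_mat zero_carrier_mat U3'
        E zero_carrier_mat zero_carrier_mat B3] right_mult_zero_mat[OF U3', of 1] U3' B3
    by simp
  then have "mat_adjoint F * B * F = four_block_mat ?E (0\<^sub>m 1 m) (0\<^sub>m m 1) (mat_adjoint U3 * B3 * U3)"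
    unfolding F_def
    using mult_four_block_mat[OF E zero_carrier_mat zero_carrier_mat UB
        one_carrier_mat zero_carrier_mat zero_carrier_mat U3(1)] right_mult_zero_mat[OF UB, of 1]
      left_add_zero_mat[OF mult_carrier_mat[OF UB U3(1)]] U3(1)
    by simp
  \<comment> \<open>Index 0 carries the eigenvalue split off; the entries of the smaller block are
    shifted by one.\<close>
  also have "\<dots> = mat_diag (Suc m) (\<lambda>i. complex_of_real (case i of 0 \<Rightarrow> Re e | Suc j \<Rightarrow> b3 j))"
    unfolding U3(3) using e by (intro eq_matI) (auto simp: mat_diag_def split: nat.splits)
  finally have FBF: "mat_adjoint F * B * F =
    mat_diag (Suc m) (\<lambda>i. complex_of_real (case i of 0 \<Rightarrow> Re e | Suc j \<Rightarrow> b3 j))" .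
  have adj: "mat_adjoint (W * F) = mat_adjoint F * mat_adjoint W"
    using mat_adjoint_mult[OF W F] .
  have "mat_adjoint (W * F) * (W * F) = mat_adjoint F * (mat_adjoint W * W) * F"
    unfolding adj using W W' F F' by (simp add: assoc_mult_mat[of _ "Suc m" "Suc m" _ "Suc m" _ "Suc m"])
  also have "\<dots> = 1\<^sub>m (Suc m)" unfolding WW right_mult_one_mat[OF F'] by (rule FF)
  finally have U1: "mat_adjoint (W * F) * (W * F) = 1\<^sub>m (Suc m)" .
  have U2: "mat_adjoint (W * F) * H * (W * F) = mat_adjoint F * B * F"
    unfolding adj B_def using W W' F F' H
    by (simp add: assoc_mult_mat[of _ "Suc m" "Suc m" _ "Suc m" _ "Suc m"])
  from mult_carrier_mat[OF W F] U1 U2[unfolded FBF] show ?case by (intro exI conjI)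
qed

section \<open>Eigenvalue multiplicities and inertia\<close>

lemma char_poly_similar_diag:
  assumes "A \<in> carrier_mat n n" "similar_mat A (mat_diag n f)"
  shows "char_poly A = (\<Prod>i<n. [:- f i, 1:])"
proof -
  have "char_poly A = char_poly (mat_diag n f)"
    using assms(2) by (rule char_poly_similar)
  also have "\<dots> = (\<Prod>a\<leftarrow>diag_mat (mat_diag n f). [:- a, 1:])"
    by (rule char_poly_upper_triangular[OF mat_diag_dim]) (auto simp: mat_diag_def)
  also have "diag_mat (mat_diag n f) = map f [0..<n]"
    by (auto simp: diag_mat_def mat_diag_def)
  also have "(\<Prod>a\<leftarrow>map f [0..<n]. [:- a, 1:]) = (\<Prod>i<n. [:- f i, 1:])"
    using prod.distinct_set_conv_list[of "[0..<n]" "\<lambda>i. [:- f i, 1:]"]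
    by (simp add: lessThan_atLeast0 o_def)
  finally show ?thesis .
qed

lemma order_prod_linear_factors:
  fixes f :: "'b \<Rightarrow> 'a :: idom"
  assumes "finite I"
  shows "Polynomial.order x (\<Prod>i\<in>I. [:- f i, 1:]) = card {i\<in>I. f i = x}"
  using assms
proof (induction I)
  case (insert k I)
  have lin: "Polynomial.order x [:- f k, 1:] = (if f k = x then 1 else 0)"
    by (auto simp: order_linear' order_0I)
  have nz: "(\<Prod>i\<in>I. [:- f i, 1:]) \<noteq> 0" using insert by auto
  have "{i\<in>insert k I. f i = x} = (if f k = x then insert k {i\<in>I. f i = x} else {i\<in>I. f i = x})"
    by auto
  moreover have "Polynomial.order x ([:- f k, 1:] * (\<Prod>i\<in>I. [:- f i, 1:])) =
      (if f k = x then 1 else 0) + card {i\<in>I. f i = x}"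
    using no_zero_divisors[OF _ nz, of "[:- f k, 1:]"] by (subst order_mult) (simp_all only: insert.IH lin, auto)
  ultimately show ?case using insert.hyps by (auto simp del: mult_pCons_left)
qed simp

lemma
  assumes A: "A \<in> carrier_mat n n" "similar_mat A (mat_diag n (\<lambda>i. complex_of_real (\<theta> i)))"
  shows eigenvalue_similar_diag: "eigenvalue A z \<longleftrightarrow> (\<exists>i<n. z = complex_of_real (\<theta> i))"
    and count_mult_similar_diag: "finite \<Lambda> \<Longrightarrow> count_mult A \<Lambda> = card {i\<in>{..<n}. \<theta> i \<in> \<Lambda>}"
proof -
  note cp = char_poly_similar_diag[OF A]
  have alg: "alg_mult A x = card {i\<in>{..<n}. \<theta> i = x}" for x
    unfolding alg_mult_def cp by (subst order_prod_linear_factors) auto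
  show "eigenvalue A z \<longleftrightarrow> (\<exists>i<n. z = complex_of_real (\<theta> i))"
    unfolding eigenvalue_root_char_poly[OF A(1)] cp poly_prod by auto
  assume fin: "finite \<Lambda>"
  have "count_mult A \<Lambda> = card (\<Union>x\<in>\<Lambda>. {i\<in>{..<n}. \<theta> i = x})"
    unfolding count_mult_def alg using fin by (intro card_UN_disjoint[symmetric]) auto
  also have "(\<Union>x\<in>\<Lambda>. {i\<in>{..<n}. \<theta> i = x}) = {i\<in>{..<n}. \<theta> i \<in> \<Lambda>}" by auto
  finally show "count_mult A \<Lambda> = card {i\<in>{..<n}. \<theta> i \<in> \<Lambda>}" .
qed

text \<open>The inertia is defined through eigenvalues, but the \<open>d i\<close> come from a
  congruence and need not be eigenvalues. A unitary diagonalization is a congruence and a similarity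
  at once: its entries \<open>b i\<close> are the eigenvalues of \<open>H\<close>, and Sylvester's
  law compares their signs with those of the \<open>d i\<close>.\<close>

theorem inertia_congruent_diag:
  assumes H: "H \<in> carrier_mat n n" "hermitian_mat H"
    and X: "X \<in> carrier_mat n n" "Y \<in> carrier_mat n n" "Y * X = 1\<^sub>m n"
    and eq: "mat_adjoint X * H * X = mat_diag n (\<lambda>i. complex_of_real (d i))"
  shows "pos_inertia H = card {i\<in>{..<n}. 0 < d i}"
    and "neg_inertia H = card {i\<in>{..<n}. d i < 0}"
proof -
  obtain U b where U: "U \<in> carrier_mat n n" "mat_adjoint U * U = 1\<^sub>m n"
    and UHU: "mat_adjoint U * H * U = mat_diag n (\<lambda>i. complex_of_real (b i))"
    using hermitian_diagonalization[OF H] by blast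
  note U' = mat_adjoint_carrier[OF U(1)]
  have UU: "U * mat_adjoint U = 1\<^sub>m n" using mat_mult_left_right_inverse[OF U' U(1) U(2)] .
  have XY: "X * Y = 1\<^sub>m n" using mat_mult_left_right_inverse[OF X(2) X(1) X(3)] .
  have "H = U * mat_diag n (\<lambda>i. complex_of_real (b i)) * mat_adjoint U"
    unfolding UHU[symmetric] using congruence_inverse[OF H(1) U(1) U' UU] by simp
  with U U' UU H have sim: "similar_mat H (mat_diag n (\<lambda>i. complex_of_real (b i)))"
    by (intro similar_matI[of _ _ _ _ n]) auto
  note X' = mat_adjoint_carrier[OF X(1)] and Y' = mat_adjoint_carrier[OF X(2)]
  \<comment> \<open>The change of basis from the eigenvector basis to the columns of
    \<open>X\<close>; it carries the diagonal of the \<open>b i\<close> to that of the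
    \<open>d i\<close>.\<close>
  let ?Z = "mat_adjoint U * X" and ?V = "Y * U"
  have "mat_adjoint ?Z * mat_diag n (\<lambda>i. complex_of_real (b i)) * ?Z =
      mat_adjoint X * (U * mat_diag n (\<lambda>i. complex_of_real (b i)) * mat_adjoint U) * X"
    using U U' X X' mat_adjoint_mult[OF U' X(1)]
    by (simp add: assoc_mult_mat[of _ n n _ n _ n] mult_carrier_mat[of _ n n _ n])
  also have "\<dots> = mat_diag n (\<lambda>i. complex_of_real (d i))"
    using eq congruence_inverse[OF H(1) U(1) U' UU] by (simp add: UHU)
  finally have cong: "mat_adjoint ?Z * mat_diag n (\<lambda>i. complex_of_real (b i)) * ?Z =
    mat_diag n (\<lambda>i. complex_of_real (d i))" .
  have "?Z * ?V = mat_adjoint U * (X * Y) * U"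
    using U U' X by (simp add: assoc_mult_mat[of _ n n _ n _ n] mult_carrier_mat[of _ n n _ n])
  then have ZV: "?Z * ?V = 1\<^sub>m n" using XY U U' by simp
  have Z: "?Z \<in> carrier_mat n n" "?V \<in> carrier_mat n n" using U U' X by auto
  note syl = sylvester_inertia_diag[OF Z ZV cong]
  have eig: "{x. eigenvalue H (complex_of_real x) \<and> Q x} = {x\<in>b ` {..<n}. Q x}" for Q
    using eigenvalue_similar_diag[OF H(1) sim] by auto
  have count: "count_mult H {x\<in>b ` {..<n}. Q x} = card {i\<in>{..<n}. Q (b i)}" for Q
    by (subst count_mult_similar_diag[OF H(1) sim]) (auto intro!: arg_cong[of _ _ card])
  show "pos_inertia H = card {i\<in>{..<n}. 0 < d i}" "neg_inertia H = card {i\<in>{..<n}. d i < 0}"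
    unfolding pos_inertia_def neg_inertia_def eig count syl by simp_all
qed

text \<open>First \<open>H\<close> is normalized to the identity by some \<open>L\<close>. A unitary
  \<open>Q\<close> can then diagonalize the transformed \<open>K\<close> without disturbing that
  identity.\<close>

theorem simultaneous_diagonalization:
  assumes H: "H \<in> carrier_mat n n" "pos_def_mat H"
    and K: "K \<in> carrier_mat n n" "hermitian_mat K"
  shows "\<exists>W V \<kappa>. W \<in> carrier_mat n n \<and> V \<in> carrier_mat n n \<and> V * W = 1\<^sub>m n \<and>
    mat_adjoint W * H * W = 1\<^sub>m n \<and>
    mat_adjoint W * K * W = mat_diag n (\<lambda>i. complex_of_real (\<kappa> i))"
proof -
  have "hermitian_mat H" using H by (simp add: pos_def_mat_def)
  then obtain U h where U: "U \<in> carrier_mat n n" "mat_adjoint U * U = 1\<^sub>m n"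
    and UHU: "mat_adjoint U * H * U = mat_diag n (\<lambda>i. complex_of_real (h i))"
    using hermitian_diagonalization[OF H(1)] by blast
  note U' = mat_adjoint_carrier[OF U(1)]
  have "pos_def_mat (mat_diag n (\<lambda>i. complex_of_real (h i)))"
    using pos_def_congruence[OF H(2,1) U(1) U' U(2)] UHU by simp
  then have h: "0 < h i" if "i < n" for i
    using that by (simp add: pos_def_diag_iff less_complex_def)
  \<comment> \<open>Positive definiteness makes every \<open>h i\<close> positive, so the inverse
    square root of the diagonal exists.\<close>
  let ?S = "mat_diag n (\<lambda>i. complex_of_real (1 / sqrt (h i)))"
  have S: "?S \<in> carrier_mat n n" by simp
  define L where "L = U * ?S"
  have L: "L \<in> carrier_mat n n" using U by (simp add: L_def)
  note L' = mat_adjoint_carrier[OF L]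
  have adjL: "mat_adjoint L = ?S * mat_adjoint U"
    unfolding L_def mat_adjoint_mult[OF U(1) S] by simp
  have "mat_adjoint L * H * L = ?S * (mat_adjoint U * H * U) * ?S"
    unfolding adjL unfolding L_def using U U' H
    by (simp add: assoc_mult_mat[of _ n n _ n _ n] mult_carrier_mat[of _ n n _ n] del: mat_diag_diag)
  also have "\<dots> = mat_diag n (\<lambda>i. complex_of_real (1 / sqrt (h i) * h i * (1 / sqrt (h i))))"
    unfolding UHU mat_diag_diag by (simp only: of_real_mult)
  also have "\<dots> = 1\<^sub>m n"
  proof (rule eq_matI)
    fix i j assume "i < dim_row (1\<^sub>m n)" "j < dim_col (1\<^sub>m n)"
    moreover have "1 / sqrt x * x * (1 / sqrt x) = 1" if "0 < x" for x :: real
      using that by (simp add: field_simps)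
    ultimately show "mat_diag n (\<lambda>i. complex_of_real (1 / sqrt (h i) * h i * (1 / sqrt (h i)))) $$ (i, j) =
        1\<^sub>m n $$ (i, j)"
      using h[of i] h[of j] by (simp add: mat_diag_def del: of_real_mult of_real_divide)
  qed auto
  finally have LHL: "mat_adjoint L * H * L = 1\<^sub>m n" .
  obtain Q \<kappa> where Q: "Q \<in> carrier_mat n n" "mat_adjoint Q * Q = 1\<^sub>m n"
    and QKQ: "mat_adjoint Q * (mat_adjoint L * K * L) * Q = mat_diag n (\<lambda>i. complex_of_real (\<kappa> i))"
    using hermitian_diagonalization[of "mat_adjoint L * K * L" n] hermitian_congruence[OF K(2,1) L] L L' K
    by auto
  note Q' = mat_adjoint_carrier[OF Q(1)]
  have adj: "mat_adjoint (L * Q) = mat_adjoint Q * mat_adjoint L"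
    using mat_adjoint_mult[OF L Q(1)] .
  have cong: "mat_adjoint (L * Q) * N * (L * Q) = mat_adjoint Q * (mat_adjoint L * N * L) * Q"
    if "N \<in> carrier_mat n n" for N
    unfolding adj using that L L' Q Q' by (simp add: assoc_mult_mat[of _ n n _ n _ n] mult_carrier_mat[of _ n n _ n])
  have WHW: "mat_adjoint (L * Q) * H * (L * Q) = 1\<^sub>m n"
    unfolding cong[OF H(1)] LHL using Q Q' by simp
  show ?thesis
  proof (intro exI conjI)
    show "L * Q \<in> carrier_mat n n" "mat_adjoint (L * Q) * H \<in> carrier_mat n n"
      using L Q H mat_adjoint_carrier[of "L * Q" n n] by auto
  qed (use WHW cong[OF K(1)] QKQ in auto)
qed

section \<open>Definitizable matrices\<close>

lemma pow_mat_diag: "mat_diag n f ^\<^sub>m k = mat_diag n (\<lambda>i. f i ^ k :: complex)"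
  by (induction k) (simp_all add: mult.commute)

lemma similarity_shift:
  fixes W V B :: "complex mat"
  assumes W: "W \<in> carrier_mat n n" and V: "V \<in> carrier_mat n n" and WV: "W * V = 1\<^sub>m n"
    and B: "B \<in> carrier_mat n n"
  shows "W * (B + c \<cdot>\<^sub>m 1\<^sub>m n) * V = W * B * V + c \<cdot>\<^sub>m 1\<^sub>m n"
proof -
  have I: "c \<cdot>\<^sub>m 1\<^sub>m n \<in> carrier_mat n n" by simp
  have "W * (B + c \<cdot>\<^sub>m 1\<^sub>m n) = W * B + c \<cdot>\<^sub>m W"
    unfolding mult_add_distrib_mat[OF W B I] mult_smult_distrib[OF W one_carrier_mat]
      right_mult_one_mat[OF W] ..
  also have "\<dots> * V = W * B * V + c \<cdot>\<^sub>m W * V"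
    using W by (intro add_mult_distrib_mat[OF mult_carrier_mat[OF W B] _ V]) simp
  finally show ?thesis unfolding mult_smult_assoc_mat[OF W V] WV .
qed

text \<open>In the coordinates given by \<open>W\<close> the power acts diagonally by
  \<open>(\<theta> i - z) ^ n\<close>. This vanishes exactly where the first power does, so the
  spectral subspace is an eigenspace, spanned by columns of \<open>W\<close>.\<close>

lemma spectral_subspace_similar_diag:
  assumes W: "W \<in> carrier_mat n n" "V \<in> carrier_mat n n" "V * W = 1\<^sub>m n"
    and A: "A = W * mat_diag n \<theta> * V"
  shows "u \<in> spectral_subspace A z \<longleftrightarrow>
    (\<exists>c\<in>carrier_vec n. u = W *\<^sub>v c \<and> (\<forall>i<n. \<theta> i \<noteq> z \<longrightarrow> c $ i = 0))"
proof -
  note WV = mat_mult_left_right_inverse[OF W(2,1,3)]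
  have dA: "A \<in> carrier_mat n n"
    unfolding A by (rule mult_carrier_mat[OF mult_carrier_mat[OF W(1) mat_diag_dim] W(2)])
  define T where "T = mat_diag n (\<lambda>i. \<theta> i - z)"
  have T: "T \<in> carrier_mat n n" by (simp add: T_def)
  have "T = mat_diag n \<theta> + (- z) \<cdot>\<^sub>m 1\<^sub>m n"
    by (rule eq_matI) (auto simp: T_def mat_diag_def)
  then have "W * T * V = A + (- z) \<cdot>\<^sub>m 1\<^sub>m n"
    using similarity_shift[OF W(1,2) WV mat_diag_dim] A by metis
  also have "\<dots> = A - z \<cdot>\<^sub>m 1\<^sub>m n" using dA by (intro eq_matI) auto
  finally have AT: "A - z \<cdot>\<^sub>m 1\<^sub>m n = W * T * V" ..
  have "similar_mat_wit (A - z \<cdot>\<^sub>m 1\<^sub>m n) T W V"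
    by (rule similar_mat_witI[of _ _ n]) (use W WV T dA AT in auto)
  then have "(A - z \<cdot>\<^sub>m 1\<^sub>m n) ^\<^sub>m n = W * T ^\<^sub>m n * V" by (rule similar_mat_wit_pow_id)
  then have pow: "(A - z \<cdot>\<^sub>m 1\<^sub>m n) ^\<^sub>m n = W * mat_diag n (\<lambda>i. (\<theta> i - z) ^ n) * V"
    by (simp add: T_def pow_mat_diag)
  let ?D = "mat_diag n (\<lambda>i. (\<theta> i - z) ^ n)"
  have mem: "u \<in> spectral_subspace A z \<longleftrightarrow> u \<in> carrier_vec n \<and> W * ?D * V *\<^sub>v u = 0\<^sub>v n" for u
    using W dA by (simp add: spectral_subspace_def mat_kernel_def pow)
  have act: "W * ?D * V *\<^sub>v (W *\<^sub>v c) = W *\<^sub>v vec n (\<lambda>i. (\<theta> i - z) ^ n * c $ i)"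
    if c: "c \<in> carrier_vec n" for c
  proof -
    have D: "?D \<in> carrier_mat n n" by simp
    have "V *\<^sub>v (W *\<^sub>v c) = c"
      using assoc_mult_mat_vec[OF W(2,1) c] W(3) c by simp
    then have "W * ?D * V *\<^sub>v (W *\<^sub>v c) = W *\<^sub>v (?D *\<^sub>v c)"
      using assoc_mult_mat_vec[OF mult_carrier_mat[OF W(1) D] W(2) mult_mat_vec_carrier[OF W(1) c]]
        assoc_mult_mat_vec[OF W(1) D c] by simp
    then show ?thesis using mat_diag_mult_vec[OF c] by simp
  qed
  have zero: "W *\<^sub>v x = 0\<^sub>v n \<longleftrightarrow> x = 0\<^sub>v n" if "x \<in> carrier_vec n" for x
    using invertible_mult_vec_nonzero[OF W that] W(1) that
    by (auto simp: mult_mat_vec_def scalar_prod_def)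
  \<comment> \<open>An index \<open>i < n\<close> forces \<open>n \<noteq> 0\<close>, so
    \<open>(\<theta> i - z) ^ n\<close> is zero precisely when
    \<open>\<theta> i = z\<close>.\<close>
  have coef: "W * ?D * V *\<^sub>v (W *\<^sub>v c) = 0\<^sub>v n \<longleftrightarrow> (\<forall>i<n. \<theta> i \<noteq> z \<longrightarrow> c $ i = 0)"
    if c: "c \<in> carrier_vec n" for c
    unfolding act[OF c] zero[OF vec_carrier] by (auto simp: vec_eq_iff)
  show ?thesis
  proof
    assume u: "u \<in> spectral_subspace A z"
    then have u: "u \<in> carrier_vec n" "W * ?D * V *\<^sub>v u = 0\<^sub>v n" using mem by auto
    have c: "V *\<^sub>v u \<in> carrier_vec n" using W u by simp
    have "W *\<^sub>v (V *\<^sub>v u) = u"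
      using assoc_mult_mat_vec[OF W(1,2) u(1)] WV u by simp
    with u c coef[OF c] show "\<exists>c\<in>carrier_vec n. u = W *\<^sub>v c \<and> (\<forall>i<n. \<theta> i \<noteq> z \<longrightarrow> c $ i = 0)"
      by (intro bexI[of _ "V *\<^sub>v u"]) auto
  next
    assume "\<exists>c\<in>carrier_vec n. u = W *\<^sub>v c \<and> (\<forall>i<n. \<theta> i \<noteq> z \<longrightarrow> c $ i = 0)"
    then show "u \<in> spectral_subspace A z" using coef mem W by auto
  qed
qed

text \<open>Normal form of a pencil that is positive definite at \<alpha>: the columns of
  \<open>W\<close> are eigenvectors of \<open>A\<close>, scaled so that
  \<open>J * A - \<alpha> J\<close> becomes the identity. This scaling is what makes the J-form of
  column \<open>i\<close> equal to \<open>1 / (\<theta> i - \<alpha>)\<close>.\<close>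

locale definitizable =
  fixes N :: nat and A J W V :: "complex mat" and \<theta> :: "nat \<Rightarrow> real" and \<alpha> :: real
  assumes W: "W \<in> carrier_mat N N" and V: "V \<in> carrier_mat N N" and VW: "V * W = 1\<^sub>m N"
    and A: "A = W * mat_diag N (\<lambda>i. complex_of_real (\<theta> i)) * V"
    and J: "J \<in> carrier_mat N N" "hermitian_mat J"
    and WJW: "mat_adjoint W * J * W = mat_diag N (\<lambda>i. complex_of_real (1 / (\<theta> i - \<alpha>)))"
    and \<theta>: "i < N \<Longrightarrow> \<theta> i \<noteq> \<alpha>"
begin

lemma WV: "W * V = 1\<^sub>m N"
  using mat_mult_left_right_inverse[OF V W VW] .

lemma A_carrier: "A \<in> carrier_mat N N"
  unfolding A by (rule mult_carrier_mat[OF mult_carrier_mat[OF W mat_diag_dim] V])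

lemma similar_A: "similar_mat A (mat_diag N (\<lambda>i. complex_of_real (\<theta> i)))"
  using W V WV VW A A_carrier by (intro similar_matI[of _ _ _ _ N]) auto

lemma qform_spectral:
  assumes "c \<in> carrier_vec N" "\<And>i. i < N \<Longrightarrow> \<theta> i \<noteq> x \<Longrightarrow> c $ i = 0"
  shows "qform J (W *\<^sub>v c) = complex_of_real ((\<Sum>i<N. (cmod (c $ i))\<^sup>2) / (x - \<alpha>))"
proof -
  have "qform J (W *\<^sub>v c) = (\<Sum>i<N. complex_of_real (1 / (\<theta> i - \<alpha>)) * of_real ((cmod (c $ i))\<^sup>2))"
    using qform_congruence[OF J(1) W assms(1)] qform_diag[OF assms(1)] WJW by simp
  \<comment> \<open>Only indices with \<open>\<theta> i = x\<close> contribute, so all weights may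
    be replaced by the constant one.\<close>
  also have "\<dots> = (\<Sum>i<N. complex_of_real ((cmod (c $ i))\<^sup>2 / (x - \<alpha>)))"
  proof (rule sum.cong)
    fix i assume "i \<in> {..<N}"
    then show "complex_of_real (1 / (\<theta> i - \<alpha>)) * of_real ((cmod (c $ i))\<^sup>2) =
        complex_of_real ((cmod (c $ i))\<^sup>2 / (x - \<alpha>))"
      using assms(2)[of i] by (cases "\<theta> i = x") auto
  qed simp
  finally show ?thesis by (simp add: sum_divide_distrib)
qed

lemma qform_spectral_sign:
  assumes u: "u \<in> spectral_subspace A (complex_of_real x)" "u \<noteq> 0\<^sub>v N"
  shows "\<exists>s>0. qform J u = complex_of_real (s / (x - \<alpha>))"
proof -
  from u spectral_subspace_similar_diag[OF W V VW A]
  obtain c where c: "c \<in> carrier_vec N" "u = W *\<^sub>v c" "\<And>i. i < N \<Longrightarrow> \<theta> i \<noteq> x \<Longrightarrow> c $ i = 0"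
    by auto
  have "c \<noteq> 0\<^sub>v N" using u(2) c(2) W by (auto simp: mult_mat_vec_def scalar_prod_def)
  with c(1) obtain k where k: "k < N" "c $ k \<noteq> 0" by (metis eq_vecI carrier_vecD index_zero_vec)
  have "0 < (\<Sum>i<N. (cmod (c $ i))\<^sup>2)" by (rule sum_pos2[of _ k]) (use k in auto)
  moreover have "qform J u = complex_of_real ((\<Sum>i<N. (cmod (c $ i))\<^sup>2) / (x - \<alpha>))"
    unfolding c(2) by (rule qform_spectral[OF c(1,3)])
  ultimately show ?thesis by (intro exI conjI)
qed

text \<open>Excludes vacuous truth: a sign condition on all nonzero spectral vectors can force a
  side of \<alpha> only if such a vector exists.\<close>

lemma ex_spectral_vec:
  assumes "k < N"
  shows "\<exists>u\<in>spectral_subspace A (complex_of_real (\<theta> k)). u \<noteq> 0\<^sub>v N"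
proof -
  have "W *\<^sub>v unit_vec N k \<in> spectral_subspace A (complex_of_real (\<theta> k))"
    unfolding spectral_subspace_similar_diag[OF W V VW A]
    by (rule bexI[of _ "unit_vec N k"]) (use assms in auto)
  moreover have "W *\<^sub>v unit_vec N k \<noteq> 0\<^sub>v N"
    using invertible_mult_vec_nonzero[OF W V VW, of "unit_vec N k"] assms by simp
  ultimately show ?thesis by blast
qed

text \<open>On the spectral subspace of \<open>x\<close> the J-form is a positive number divided by
  \<open>x - \<alpha>\<close>. Its sign is thus the same for all nonzero vectors, and no eigenvalue
  is of mixed or neutral type.\<close>

lemma J_eigenvalues:
  "J_positive_eigenvalues J A = {x\<in>\<theta> ` {..<N}. \<alpha> < x}"
  "J_negative_eigenvalues J A = {x\<in>\<theta> ` {..<N}. x < \<alpha>}"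
proof -
  have dim: "dim_row A = N" using A_carrier by simp
  have ev: "eigenvalue A (complex_of_real x) \<longleftrightarrow> x \<in> \<theta> ` {..<N}" for x
    using eigenvalue_similar_diag[OF A_carrier similar_A] by auto
  have sgn: "(\<forall>u\<in>spectral_subspace A (complex_of_real x). u \<noteq> 0\<^sub>v N \<longrightarrow> 0 < qform J u) \<longleftrightarrow> \<alpha> < x"
    "(\<forall>u\<in>spectral_subspace A (complex_of_real x). u \<noteq> 0\<^sub>v N \<longrightarrow> qform J u < 0) \<longleftrightarrow> x < \<alpha>"
    if x: "x \<in> \<theta> ` {..<N}" for x
  proof -
    from x \<theta> have "x \<noteq> \<alpha>" by auto
    have pos: "0 < qform J u \<longleftrightarrow> \<alpha> < x" "qform J u < 0 \<longleftrightarrow> x < \<alpha>"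
      if "u \<in> spectral_subspace A (complex_of_real x)" "u \<noteq> 0\<^sub>v N" for u
      using qform_spectral_sign[OF that] \<open>x \<noteq> \<alpha>\<close>
      by (auto simp: less_complex_def zero_less_divide_iff divide_less_0_iff)
    from x ex_spectral_vec obtain u where "u \<in> spectral_subspace A (complex_of_real x)" "u \<noteq> 0\<^sub>v N"
      by auto
    then show "(\<forall>u\<in>spectral_subspace A (complex_of_real x). u \<noteq> 0\<^sub>v N \<longrightarrow> 0 < qform J u) \<longleftrightarrow> \<alpha> < x"
      "(\<forall>u\<in>spectral_subspace A (complex_of_real x). u \<noteq> 0\<^sub>v N \<longrightarrow> qform J u < 0) \<longleftrightarrow> x < \<alpha>"
      using pos by blast+
  qed
  show "J_positive_eigenvalues J A = {x\<in>\<theta> ` {..<N}. \<alpha> < x}"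
    "J_negative_eigenvalues J A = {x\<in>\<theta> ` {..<N}. x < \<alpha>}"
    unfolding J_positive_eigenvalues_def J_negative_eigenvalues_def dim ev using sgn by blast+
qed

lemma count_eigenvalues:
  "count_mult A {x\<in>\<theta> ` {..<N}. Q x} = card {i\<in>{..<N}. Q (\<theta> i)}"
  by (subst count_mult_similar_diag[OF A_carrier similar_A]) (auto intro!: arg_cong[of _ _ card])

lemma pencil_congruence:
  "mat_adjoint W * (J * A - complex_of_real \<mu> \<cdot>\<^sub>m J) * W =
    mat_diag N (\<lambda>i. complex_of_real ((\<theta> i - \<mu>) / (\<theta> i - \<alpha>)))"
proof -
  let ?D = "mat_diag N (\<lambda>i. complex_of_real (\<theta> i))"
  let ?K = "mat_diag N (\<lambda>i. complex_of_real (1 / (\<theta> i - \<alpha>)))"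
  note W' = mat_adjoint_carrier[OF W]
  have D: "?D \<in> carrier_mat N N" by simp
  have JA: "J * A \<in> carrier_mat N N" using J A_carrier by simp
  have S: "complex_of_real \<mu> \<cdot>\<^sub>m J \<in> carrier_mat N N" using J by simp
  note assoc = assoc_mult_mat[of _ N N _ N _ N] mult_carrier_mat[of _ N N _ N]
  have "A * W = W * ?D * (V * W)"
    unfolding A by (simp only: assoc W V D)
  then have AW: "A * W = W * ?D"
    unfolding VW right_mult_one_mat[OF mult_carrier_mat[OF W D]] .
  have "mat_adjoint W * (J * A) * W = mat_adjoint W * J * (A * W)"
    by (simp only: assoc W W' J A_carrier)
  also have "\<dots> = (mat_adjoint W * J * W) * ?D"
    unfolding AW by (simp only: assoc W W' J D)
  finally have 1: "mat_adjoint W * (J * A) * W = ?K * ?D" unfolding WJW .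
  have 2: "mat_adjoint W * (complex_of_real \<mu> \<cdot>\<^sub>m J) * W = complex_of_real \<mu> \<cdot>\<^sub>m ?K"
    unfolding mult_smult_distrib[OF W' J(1)] mult_smult_assoc_mat[OF mult_carrier_mat[OF W' J(1)] W] WJW ..
  have "mat_adjoint W * (J * A - complex_of_real \<mu> \<cdot>\<^sub>m J) * W = ?K * ?D - complex_of_real \<mu> \<cdot>\<^sub>m ?K"
    unfolding mult_minus_distrib_mat[OF W' JA S]
      minus_mult_distrib_mat[OF mult_carrier_mat[OF W' JA] mult_carrier_mat[OF W' S] W] 1 2 ..
  also have "\<dots> = mat_diag N (\<lambda>i. complex_of_real ((\<theta> i - \<mu>) / (\<theta> i - \<alpha>)))"
    unfolding mat_diag_diag by (rule eq_matI) (auto simp: mat_diag_def diff_divide_distrib)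
  finally show ?thesis .
qed

lemma pencil_carrier: "J * A - complex_of_real \<mu> \<cdot>\<^sub>m J \<in> carrier_mat N N"
  using J A_carrier by auto

lemma pencil_hermitian: "hermitian_mat (J * A - complex_of_real \<mu> \<cdot>\<^sub>m J)"
proof -
  let ?H = "J * A - complex_of_real \<mu> \<cdot>\<^sub>m J"
  have "hermitian_mat (mat_diag N (\<lambda>i. complex_of_real ((\<theta> i - \<mu>) / (\<theta> i - \<alpha>))))"
    by (simp add: hermitian_mat_def)
  from hermitian_congruence[OF this mat_diag_dim V]
  show ?thesis using congruence_inverse[OF pencil_carrier W V WV] pencil_congruence by simp
qed

lemma pencil_pos_def_iff:
  "pos_def_mat (J * A - complex_of_real \<mu> \<cdot>\<^sub>m J) \<longleftrightarrow> (\<forall>i<N. 0 < (\<theta> i - \<mu>) / (\<theta> i - \<alpha>))"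
  using pos_def_congruence_iff[OF pencil_carrier W V VW] pencil_congruence
  by (simp add: pos_def_diag_iff less_complex_def)

lemma pencil_inertia:
  "pos_inertia (J * A - complex_of_real \<mu> \<cdot>\<^sub>m J) = card {i\<in>{..<N}. 0 < (\<theta> i - \<mu>) / (\<theta> i - \<alpha>)}"
  "neg_inertia (J * A - complex_of_real \<mu> \<cdot>\<^sub>m J) = card {i\<in>{..<N}. (\<theta> i - \<mu>) / (\<theta> i - \<alpha>) < 0}"
  using inertia_congruent_diag[OF pencil_carrier pencil_hermitian W V VW pencil_congruence] by blast+

end

text \<open>Because \<open>J * J\<close> is the identity, \<open>J * H\<close> equals
  \<open>A - \<alpha> I\<close>. Once \<open>H\<close> is the identity and \<open>J\<close> the
  diagonal of the \<open>\<kappa> i\<close>, the same identity shows that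
  \<open>A - \<alpha> I\<close> is represented by the inverse of that diagonal.\<close>

lemma definitizable_diagonalization:
  assumes A: "A \<in> carrier_mat N N" and J: "J \<in> carrier_mat N N" "hermitian_mat J" "J * J = 1\<^sub>m N"
    and pd: "pos_def_mat (J * A - complex_of_real \<alpha> \<cdot>\<^sub>m J)"
  shows "\<exists>W V \<theta>. definitizable N A J W V \<theta> \<alpha>"
proof -
  define H where "H = J * A - complex_of_real \<alpha> \<cdot>\<^sub>m J"
  have H: "H \<in> carrier_mat N N" using A J by (auto simp: H_def)
  obtain W V \<kappa> where W: "W \<in> carrier_mat N N" "V \<in> carrier_mat N N" "V * W = 1\<^sub>m N"
    and WHW: "mat_adjoint W * H * W = 1\<^sub>m N"
    and WJW: "mat_adjoint W * J * W = mat_diag N (\<lambda>i. complex_of_real (\<kappa> i))"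
    using simultaneous_diagonalization[OF H _ J(1,2)] pd H_def by auto
  note W' = mat_adjoint_carrier[OF W(1)] and WV = mat_mult_left_right_inverse[OF W(2,1,3)]
  let ?K = "mat_diag N (\<lambda>i. complex_of_real (\<kappa> i))"
  have K: "?K \<in> carrier_mat N N" by simp
  \<comment> \<open>The matrix of \<open>A - \<alpha> I\<close> in the basis formed by the columns
    of \<open>W\<close>.\<close>
  define B where "B = V * (J * H) * W"
  have B: "B \<in> carrier_mat N N"
    unfolding B_def by (rule mult_carrier_mat[OF mult_carrier_mat[OF W(2) mult_carrier_mat[OF J(1) H]] W(1)])
  note assoc = assoc_mult_mat[of _ N N _ N _ N] mult_carrier_mat[of _ N N _ N]
  note JH = mult_carrier_mat[OF J(1) H]
  have "?K * B = mat_adjoint W * J * (W * V) * (J * H) * W"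
    unfolding WJW[symmetric] B_def by (simp only: assoc W W' J(1) H)
  also have "\<dots> = mat_adjoint W * J * (J * H) * W"
    unfolding WV right_mult_one_mat[OF mult_carrier_mat[OF W' J(1)]] ..
  also have "\<dots> = mat_adjoint W * (J * J) * H * W"
    by (simp only: assoc W W' J(1) H)
  finally have KB: "?K * B = 1\<^sub>m N" unfolding J(3) right_mult_one_mat[OF W'] WHW .
  have KBij: "complex_of_real (\<kappa> i) * B $$ (i, j) = (if i = j then 1 else 0)" if "i < N" "j < N" for i j
    using arg_cong[OF KB, of "\<lambda>M. M $$ (i, j)"] that mat_diag_mult_left[OF B] by simp
  \<comment> \<open>Invertibility of \<open>J\<close> enters here: the product \<open>?K * B\<close>
    is the identity, so no diagonal entry of \<open>?K\<close> is zero.\<close>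
  have \<kappa>: "\<kappa> i \<noteq> 0" if "i < N" for i using KBij[of i i] that by auto
  have Bd: "B = mat_diag N (\<lambda>i. complex_of_real (1 / \<kappa> i))"
  proof (rule eq_matI)
    fix i j assume "i < dim_row (mat_diag N (\<lambda>i. complex_of_real (1 / \<kappa> i)))"
      "j < dim_col (mat_diag N (\<lambda>i. complex_of_real (1 / \<kappa> i)))"
    then have "i < N" "j < N" by simp_all
    with KBij[of i j] \<kappa>[of i] show "B $$ (i, j) = mat_diag N (\<lambda>i. complex_of_real (1 / \<kappa> i)) $$ (i, j)"
      by (auto simp: mat_diag_def field_simps split: if_splits)
  qed (use B in auto)
  define \<theta> where "\<theta> i = \<alpha> + 1 / \<kappa> i" for i
  have "J * H = J * J * A - complex_of_real \<alpha> \<cdot>\<^sub>m (J * J)"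
    unfolding H_def using mult_minus_distrib_mat[OF J(1) mult_carrier_mat[OF J(1) A] smult_carrier_mat[OF J(1)]]
      mult_smult_distrib[OF J(1) J(1)] assoc_mult_mat[OF J(1) J(1) A] by simp
  then have "J * H = A - complex_of_real \<alpha> \<cdot>\<^sub>m 1\<^sub>m N"
    unfolding J(3) left_mult_one_mat[OF A] .
  moreover have "W * B * V = (W * V) * (J * H) * (W * V)"
    unfolding B_def by (simp only: assoc W J(1) H)
  then have "W * B * V = J * H"
    unfolding WV left_mult_one_mat[OF JH] right_mult_one_mat[OF JH] .
  ultimately have "A = W * B * V + complex_of_real \<alpha> \<cdot>\<^sub>m 1\<^sub>m N"
    using A by (intro eq_matI) auto
  also have "\<dots> = W * (B + complex_of_real \<alpha> \<cdot>\<^sub>m 1\<^sub>m N) * V"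
    by (rule similarity_shift[symmetric, OF W(1,2) WV B])
  also have "B + complex_of_real \<alpha> \<cdot>\<^sub>m 1\<^sub>m N = mat_diag N (\<lambda>i. complex_of_real (\<theta> i))"
    unfolding Bd by (rule eq_matI) (auto simp: mat_diag_def \<theta>_def)
  finally have "A = W * mat_diag N (\<lambda>i. complex_of_real (\<theta> i)) * V" .
  with W J WJW \<kappa> show ?thesis
    by (intro exI[of _ W] exI[of _ V] exI[of _ \<theta>]) (unfold_locales, auto simp: \<theta>_def)
qed

section \<open>Hyperbolic quadratic matrix polynomials\<close>

text \<open>The form of a Hermitian matrix is real, so nothing is lost by taking the real part, and
  continuity and sign arguments can be carried out over the reals.\<close>

definition rform :: "complex mat \<Rightarrow> complex vec \<Rightarrow> real" where
  "rform N x = Re (qform N x)"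

lemma qform_eq_rform:
  assumes "hermitian_mat N" "N \<in> carrier_mat n n" "x \<in> carrier_vec n"
  shows "qform N x = of_real (rform N x)"
  using qform_hermitian_real[OF assms] by (simp add: rform_def complex_eq_iff)

lemma rform_smult_mat:
  assumes "N \<in> carrier_mat n n" "x \<in> carrier_vec n"
  shows "rform (of_real c \<cdot>\<^sub>m N) x = c * rform N x"
  using qform_smult_mat[OF assms] by (simp add: rform_def)

lemma rform_add_mat:
  assumes "A \<in> carrier_mat n n" "B \<in> carrier_mat n n" "x \<in> carrier_vec n"
  shows "rform (A + B) x = rform A x + rform B x"
  using qform_add_mat[OF assms] by (simp add: rform_def)

lemma qform_sum:
  assumes "N \<in> carrier_mat n n" "x \<in> carrier_vec n"
  shows "qform N x = (\<Sum>i<n. \<Sum>j<n. cnj (x $ i) * N $$ (i, j) * x $ j)"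
  using assms by (simp add: qform_def scalar_prod_def sum_distrib_left lessThan_atLeast0 mult.assoc)

lemma rform_smult_vec:
  assumes "N \<in> carrier_mat n n" "x \<in> carrier_vec n"
  shows "rform N (c \<cdot>\<^sub>v x) = (cmod c)\<^sup>2 * rform N x"
proof -
  have "qform N (c \<cdot>\<^sub>v x) = (c * cnj c) * qform N x"
    using assms by (simp add: qform_sum[of _ n] sum_distrib_left mult_ac)
  then show ?thesis by (simp add: rform_def complex_norm_square[symmetric])
qed

text \<open>The factor \<open>u\<close> is kept apart from the real coefficients because it enters
  the cross term only through \<open>Re (u * s)\<close>: a suitable phase cancels that term for all
  \<open>a\<close> and \<open>b\<close> simultaneously.\<close>

lemma rform_segment:
  assumes N: "N \<in> carrier_mat n n" "hermitian_mat N"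
    and x: "x \<in> carrier_vec n" and y: "y \<in> carrier_vec n"
  shows "rform N (of_real a \<cdot>\<^sub>v x + (of_real b * u) \<cdot>\<^sub>v y) =
    a\<^sup>2 * rform N x + b\<^sup>2 * (cmod u)\<^sup>2 * rform N y + 2 * a * b * Re (u * (conjugate x \<bullet> (N *\<^sub>v y)))"
proof -
  define s where "s = conjugate x \<bullet> (N *\<^sub>v y)"
  have s: "s = (\<Sum>i<n. \<Sum>j<n. cnj (x $ i) * N $$ (i, j) * y $ j)"
    using N x y by (simp add: s_def scalar_prod_def sum_distrib_left lessThan_atLeast0 mult.assoc)
  have sym: "cnj (N $$ (i, j)) = N $$ (j, i)" if "i < n" "j < n" for i j
  proof -
    have "mat_adjoint N $$ (j, i) = cnj (N $$ (i, j))" using N that by simp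
    then show ?thesis using N by (simp add: hermitian_mat_def)
  qed
  have "cnj s = (\<Sum>i<n. \<Sum>j<n. cnj (y $ j) * N $$ (j, i) * x $ i)"
    unfolding s using sym by (simp add: mult_ac)
  also have "\<dots> = (\<Sum>i<n. \<Sum>j<n. cnj (y $ i) * N $$ (i, j) * x $ j)" by (rule sum.swap)
  finally have cs: "cnj s = (\<Sum>i<n. \<Sum>j<n. cnj (y $ i) * N $$ (i, j) * x $ j)" .
  have z: "of_real a \<cdot>\<^sub>v x + (of_real b * u) \<cdot>\<^sub>v y \<in> carrier_vec n" using x y by simp
  have "qform N (of_real a \<cdot>\<^sub>v x + (of_real b * u) \<cdot>\<^sub>v y) =
     (\<Sum>i<n. \<Sum>j<n. of_real (a\<^sup>2) * (cnj (x $ i) * N $$ (i, j) * x $ j)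
       + of_real (b\<^sup>2) * (u * cnj u) * (cnj (y $ i) * N $$ (i, j) * y $ j)
       + of_real (a * b) * u * (cnj (x $ i) * N $$ (i, j) * y $ j)
       + of_real (a * b) * cnj u * (cnj (y $ i) * N $$ (i, j) * x $ j))"
    unfolding qform_sum[OF N(1) z] using x y
    by (intro sum.cong refl) (simp add: algebra_simps power2_eq_square)
  also have "\<dots> = of_real (a\<^sup>2) * qform N x + of_real (b\<^sup>2) * (u * cnj u) * qform N y
      + of_real (a * b) * u * s + of_real (a * b) * cnj u * cnj s"
    unfolding qform_sum[OF N(1) x] qform_sum[OF N(1) y] cs unfolding s
    by (simp add: sum.distrib sum_distrib_left)
  also have "\<dots> = of_real (a\<^sup>2) * qform N x + of_real (b\<^sup>2) * (u * cnj u) * qform N y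
      + of_real (2 * a * b * Re (u * s))"
    unfolding add.assoc by (simp add: complex_eq_iff algebra_simps)
  finally show ?thesis
    unfolding rform_def complex_norm_square[symmetric] s_def by (simp flip: of_real_power)
qed

text \<open>The source of double roots: with \<open>Q\<close> the form of the polynomial at a point
  and \<open>H\<close> that of its derivative there, a common zero is a vector for which this point
  is a double root. It arises from the intermediate value theorem for \<open>H\<close> along a curve
  on which \<open>Q\<close> stays zero.\<close>

lemma ex_common_isotropic:
  assumes Q: "Q \<in> carrier_mat n n" "hermitian_mat Q" and H: "H \<in> carrier_mat n n" "hermitian_mat H"
    and x: "x \<in> carrier_vec n" "rform Q x = 0" "rform H x < 0"
    and y: "y \<in> carrier_vec n" "rform Q y = 0" "0 < rform H y"
  shows "\<exists>z\<in>carrier_vec n. z \<noteq> 0\<^sub>v n \<and> rform Q z = 0 \<and> rform H z = 0"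
proof -
  \<comment> \<open>The phase \<open>u\<close> makes the cross term vanish, so the segment from \<open>x\<close> to \<open>u y\<close> consists of zeros of \<open>Q\<close>.\<close>
  define b where "b = conjugate x \<bullet> (Q *\<^sub>v y)"
  define u where "u = (if b = 0 then 1 else \<i> * cnj b / of_real (cmod b))"
  have u: "cmod u = 1" by (simp add: u_def norm_mult norm_divide)
  have "Re (\<i> * cnj b * b / of_real (cmod b)) = 0" by (simp add: complex_is_Real_iff algebra_simps)
  then have ub: "Re (u * b) = 0" by (auto simp: u_def)
  define z where "z t = of_real (1 - t) \<cdot>\<^sub>v x + (of_real t * u) \<cdot>\<^sub>v y" for t :: real
  have z: "z t \<in> carrier_vec n" for t using x y by (simp add: z_def)
  have Qz: "rform Q (z t) = 0" for t
    unfolding z_def rform_segment[OF Q x(1) y(1)] using x y ub by (simp add: b_def)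
  define h where "h t = (1 - t)\<^sup>2 * rform H x + t\<^sup>2 * rform H y
    + 2 * (1 - t) * t * Re (u * (conjugate x \<bullet> (H *\<^sub>v y)))" for t
  have Hz: "rform H (z t) = h t" for t
    unfolding z_def rform_segment[OF H x(1) y(1)] by (simp add: h_def u)
  have "\<exists>t. 0 \<le> t \<and> t \<le> 1 \<and> h t = 0"
  proof (rule IVT')
    show "continuous_on {0..1} h" unfolding h_def by (intro continuous_intros)
  qed (use x y in \<open>auto simp: h_def\<close>)
  then obtain t where t: "h t = 0" by blast
  \<comment> \<open>At \<open>z t = 0\<close> a multiple of \<open>x\<close> would equal a multiple
    of \<open>y\<close>. Since \<open>H\<close> is negative at \<open>x\<close> and positive at
    \<open>y\<close>, both coefficients would be zero, yet \<open>t\<close> and \<open>1 - t\<close>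
    cannot vanish together.\<close>
  have "z t \<noteq> 0\<^sub>v n"
  proof
    assume 0: "z t = 0\<^sub>v n"
    have "of_real (1 - t) \<cdot>\<^sub>v x = (- of_real t * u) \<cdot>\<^sub>v y"
    proof (rule eq_vecI)
      fix i assume "i < dim_vec ((- of_real t * u) \<cdot>\<^sub>v y)"
      then show "(of_real (1 - t) \<cdot>\<^sub>v x) $ i = ((- of_real t * u) \<cdot>\<^sub>v y) $ i"
        using arg_cong[OF 0, of "\<lambda>v. v $ i"] x y by (simp add: z_def add_eq_0_iff2)
    qed (use x y in auto)
    then have "rform H (of_real (1 - t) \<cdot>\<^sub>v x) = rform H ((- of_real t * u) \<cdot>\<^sub>v y)" by simp
    then have eq: "(1 - t)\<^sup>2 * rform H x = t\<^sup>2 * rform H y"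
      unfolding rform_smult_vec[OF H(1) x(1)] rform_smult_vec[OF H(1) y(1)]
      by (simp add: norm_mult u flip: of_real_diff del: of_real_diff)
    have "(1 - t)\<^sup>2 * rform H x \<le> 0" "0 \<le> t\<^sup>2 * rform H y"
      using x y by (auto simp: mult_nonneg_nonpos)
    then have "(1 - t)\<^sup>2 * rform H x = 0" "t\<^sup>2 * rform H y = 0" using eq by linarith+
    then show False using x y by simp
  qed
  with z Qz Hz t show ?thesis by (intro bexI[of _ "z t"]) auto
qed

text \<open>The dimension of a vector is not part of its type, so compactness is taken in the product topology
  on functions.\<close>

lemma compact_unit_sphere:
  "compact {f :: nat \<Rightarrow> complex. (\<forall>i\<ge>n. f i = 0) \<and> (\<Sum>i<n. (cmod (f i))\<^sup>2) = 1}" (is "compact ?S")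
proof -
  have coord: "continuous_on UNIV (\<lambda>f :: nat \<Rightarrow> complex. f i)" for i
    by (rule continuous_on_product_coordinates)
  \<comment> \<open>A square containing every coordinate of a unit vector. By Tychonoff the product
    of copies of \<open>R\<close> is compact, and the sphere is a closed subset of it.\<close>
  define R where "R = (\<lambda>p. of_real (fst p) + \<i> * of_real (snd p)) ` ({-1..1 :: real} \<times> {-1..1 :: real})"
  have "compact R" unfolding R_def
    by (intro compact_continuous_image compact_Times compact_Icc continuous_intros)
  then have "compactin (product_topology (\<lambda>i. euclidean) UNIV) (PiE UNIV (\<lambda>_ :: nat. R))"
    by (simp add: compactin_PiE)
  then have box: "compact (PiE UNIV (\<lambda>_ :: nat. R))"
    by (simp add: euclidean_product_topology)
  have "closed {f :: nat \<Rightarrow> complex. (\<forall>i\<ge>n. f i = 0)}"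
    using coord by (intro closed_Collect_all closed_Collect_imp closed_Collect_eq) (auto simp: continuous_on_const)
  moreover have "closed {f :: nat \<Rightarrow> complex. (\<Sum>i<n. (cmod (f i))\<^sup>2) = 1}"
    using coord by (intro closed_Collect_eq continuous_intros) auto
  ultimately have "closed ?S" by (simp add: closed_Int Collect_conj_eq)
  moreover have "?S \<subseteq> PiE UNIV (\<lambda>_ :: nat. R)"
  proof safe
    fix f :: "nat \<Rightarrow> complex" and i
    assume f: "\<forall>i\<ge>n. f i = 0" "(\<Sum>i<n. (cmod (f i))\<^sup>2) = 1"
    have "cmod (f i) \<le> 1"
    proof (cases "i < n")
      case True
      then have "(cmod (f i))\<^sup>2 \<le> (\<Sum>i<n. (cmod (f i))\<^sup>2)" by (intro member_le_sum) auto
      then show ?thesis using f abs_square_le_1[of "cmod (f i)"] by simp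
    qed (use f in auto)
    then have "\<bar>Re (f i)\<bar> \<le> 1" "\<bar>Im (f i)\<bar> \<le> 1"
      using abs_Re_le_cmod[of "f i"] abs_Im_le_cmod[of "f i"] by linarith+
    then show "f i \<in> R" unfolding R_def
      by (intro image_eqI[of _ _ "(Re (f i), Im (f i))"]) (auto simp: complex_eq)
  qed auto
  then have "PiE UNIV (\<lambda>_ :: nat. R) \<inter> ?S = ?S" by (rule Int_absorb1)
  ultimately show ?thesis using compact_Int_closed[OF box, of ?S] by argo
qed

lemma continuous_on_rform:
  assumes "N \<in> carrier_mat n n"
  shows "continuous_on S (\<lambda>f. rform N (vec n f))"
proof -
  have coord: "continuous_on S (\<lambda>f :: nat \<Rightarrow> complex. f i)" for i
    by (rule continuous_on_subset[OF continuous_on_product_coordinates subset_UNIV])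
  have "rform N (vec n f) = Re (\<Sum>i<n. \<Sum>j<n. cnj (f i) * N $$ (i, j) * f j)" for f
    by (simp add: rform_def qform_sum[OF assms])
  then show ?thesis using coord by (simp del: Re_sum) (intro continuous_intros)
qed

text \<open>The largest smaller root and the smallest larger root are attained, at \<open>f\<close>
  and \<open>g\<close>. A single comparison of two vectors therefore yields a whole interval on
  which all forms are negative. The assumption \<open>0 < n\<close> makes the sphere nonempty, so
  that extrema exist.\<close>

theorem hyperbolic_separation:
  assumes M: "M \<in> carrier_mat n n" "pos_def_mat M"
    and D: "D \<in> carrier_mat n n" "hermitian_mat D"
    and K: "K \<in> carrier_mat n n" "hermitian_mat K"
    and disc: "\<And>x. x \<in> carrier_vec n \<Longrightarrow> x \<noteq> 0\<^sub>v n \<Longrightarrow>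
      0 < (rform D x)\<^sup>2 - 4 * rform M x * rform K x"
    and n: "0 < n"
  shows "\<exists>\<alpha>::real. \<forall>x\<in>carrier_vec n. x \<noteq> 0\<^sub>v n \<longrightarrow>
    \<alpha>\<^sup>2 * rform M x + \<alpha> * rform D x + rform K x < 0"
proof -
  define \<Delta> where "\<Delta> x = (rform D x)\<^sup>2 - 4 * rform M x * rform K x" for x
  have \<Delta>: "0 < \<Delta> x" if "x \<in> carrier_vec n" "x \<noteq> 0\<^sub>v n" for x
    using disc that by (simp add: \<Delta>_def)
  have m: "0 < rform M x" if "x \<in> carrier_vec n" "x \<noteq> 0\<^sub>v n" for x
    using M that by (auto simp: pos_def_mat_def rform_def less_complex_def)
  have Mh: "hermitian_mat M" using M by (simp add: pos_def_mat_def)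
  define Q where "Q a = of_real (a\<^sup>2) \<cdot>\<^sub>m M + of_real a \<cdot>\<^sub>m D + K" for a :: real
  define H where "H a = of_real (2 * a) \<cdot>\<^sub>m M + D" for a :: real
  have Q: "Q a \<in> carrier_mat n n" "hermitian_mat (Q a)" for a
    using M D K Mh
    by (auto simp: Q_def hermitian_mat_def mat_adjoint_add[of _ n n] simp del: of_real_power)
  have H: "H a \<in> carrier_mat n n" "hermitian_mat (H a)" for a
    using M D Mh by (auto simp: H_def hermitian_mat_def mat_adjoint_add[of _ n n])
  have Qx: "rform (Q a) x = a\<^sup>2 * rform M x + a * rform D x + rform K x"
    and Hx: "rform (H a) x = 2 * a * rform M x + rform D x" if "x \<in> carrier_vec n" for a x
    using that M(1) D(1) K(1)
    by (simp_all add: Q_def H_def rform_add_mat[of _ n] rform_smult_mat[of _ n] del: of_real_power of_real_mult)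
  \<comment> \<open>\<open>H a\<close> is the derivative of \<open>Q\<close> at \<open>a\<close>; its sign tells which of the two roots \<open>a\<close> is.\<close>
  have square: "4 * rform M x * rform (Q a) x = (rform (H a) x)\<^sup>2 - \<Delta> x" if "x \<in> carrier_vec n" for a x
    unfolding Qx[OF that] Hx[OF that] \<Delta>_def by (simp add: power2_eq_square algebra_simps)
  have root: "rform (Q a) x = 0" if "x \<in> carrier_vec n" "x \<noteq> 0\<^sub>v n" "\<bar>rform (H a) x\<bar> = sqrt (\<Delta> x)" for a x
  proof -
    have "(rform (H a) x)\<^sup>2 = \<Delta> x"
      using that(3) \<Delta>[OF that(1,2)] by (metis power2_abs real_sqrt_pow2 less_imp_le)
    then show ?thesis using square[OF that(1), of a] m[OF that(1,2)] by simp
  qed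
  \<comment> \<open>Here \<open>a\<close> is the smaller root for \<open>x\<close> and the larger
    root for \<open>y\<close>. The common zero of \<open>Q a\<close> and \<open>H a\<close> supplied
    by these two vectors would have discriminant zero by \<open>square\<close>.\<close>
  have no_common: False
    if x: "x \<in> carrier_vec n" "x \<noteq> 0\<^sub>v n" "rform (H a) x = - sqrt (\<Delta> x)"
      and y: "y \<in> carrier_vec n" "y \<noteq> 0\<^sub>v n" "rform (H a) y = sqrt (\<Delta> y)" for a x y
  proof -
    have "rform (Q a) x = 0" "rform (H a) x < 0" "rform (Q a) y = 0" "0 < rform (H a) y"
      using root[OF x(1,2), of a] root[OF y(1,2), of a] x y \<Delta>[OF x(1,2)] \<Delta>[OF y(1,2)] by auto
    from ex_common_isotropic[OF Q H x(1) this(1,2) y(1) this(3,4)]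
    obtain z where z: "z \<in> carrier_vec n" "z \<noteq> 0\<^sub>v n" "rform (Q a) z = 0" "rform (H a) z = 0" by blast
    then show False using square[OF z(1), of a] \<Delta>[OF z(1,2)] by simp
  qed
  \<comment> \<open>Suppose that \<open>a\<close>, the smaller root for \<open>x\<close>, is not
    below the larger root for \<open>y\<close>. Along the segment from \<open>x\<close> to
    \<open>y\<close> the larger root starts above \<open>a\<close> and ends at or below it, so it
    equals \<open>a\<close> for some vector on the way, which together with \<open>x\<close>
    contradicts \<open>no_common\<close>.\<close>
  have separated: "rform (H a) y < sqrt (\<Delta> y)"
    if x: "x \<in> carrier_vec n" "x \<noteq> 0\<^sub>v n" "rform (H a) x = - sqrt (\<Delta> x)"
      and y: "y \<in> carrier_vec n" "y \<noteq> 0\<^sub>v n" for a x y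
  proof (rule ccontr)
    assume "\<not> rform (H a) y < sqrt (\<Delta> y)"
    then have Hy: "sqrt (\<Delta> y) \<le> rform (H a) y" by simp
    define z where "z t = of_real (1 - t) \<cdot>\<^sub>v x + (of_real t * 1) \<cdot>\<^sub>v y" for t :: real
    have z: "z t \<in> carrier_vec n" for t using x y by (simp add: z_def)
    have cont: "continuous_on {0..1} (\<lambda>t. rform N (z t))" if "N \<in> carrier_mat n n" "hermitian_mat N" for N
      unfolding z_def rform_segment[OF that x(1) y(1)] by (intro continuous_intros)
    \<comment> \<open>A zero of \<open>h\<close> is a vector whose larger root is \<open>a\<close>, without dividing by the leading coefficient.\<close>
    define h where "h t = rform (H a) (z t) - sqrt (\<Delta> (z t))" for t
    have z01: "z 0 = x" "z 1 = y" using x y by (auto simp: z_def)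
    have "\<exists>t. 0 \<le> t \<and> t \<le> 1 \<and> h t = 0"
    proof (rule IVT')
      show "continuous_on {0..1} h" unfolding h_def \<Delta>_def
        using cont M Mh D K H by (intro continuous_intros) auto
    qed (use x Hy \<Delta>[OF x(1,2)] in \<open>auto simp: h_def z01\<close>)
    then obtain t where t: "h t = 0" by blast
    have "z t \<noteq> 0\<^sub>v n"
    proof
      assume 0: "z t = 0\<^sub>v n"
      have "of_real (1 - t) \<cdot>\<^sub>v x = of_real (- t) \<cdot>\<^sub>v y"
      proof (rule eq_vecI)
        fix i assume "i < dim_vec (of_real (- t) \<cdot>\<^sub>v y)"
        then show "(of_real (1 - t) \<cdot>\<^sub>v x) $ i = (of_real (- t) \<cdot>\<^sub>v y) $ i"
          using arg_cong[OF 0, of "\<lambda>v. v $ i"] x y by (simp add: z_def add_eq_0_iff2)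
      qed (use x y in auto)
      then have "rform (H a) (of_real (1 - t) \<cdot>\<^sub>v x) = rform (H a) (of_real (- t) \<cdot>\<^sub>v y)" by simp
      then have eq: "(1 - t)\<^sup>2 * rform (H a) x = t\<^sup>2 * rform (H a) y"
        unfolding rform_smult_vec[OF H(1) x(1)] rform_smult_vec[OF H(1) y(1)] norm_of_real
        by simp
      have neg: "rform (H a) x < 0" "0 < rform (H a) y"
        using x(3) Hy real_sqrt_gt_zero[OF \<Delta>[OF x(1,2)]] real_sqrt_gt_zero[OF \<Delta>[OF y]] by linarith+
      have "(1 - t)\<^sup>2 * rform (H a) x \<le> 0" "0 \<le> t\<^sup>2 * rform (H a) y"
        using neg by (auto simp: mult_nonneg_nonpos)
      then have "(1 - t)\<^sup>2 * rform (H a) x = 0" "t\<^sup>2 * rform (H a) y = 0" using eq by linarith+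
      then show False using neg by simp
    qed
    with no_common[OF x z, of t] t show False by (simp add: h_def)
  qed
  \<comment> \<open>Unit vectors encoded as functions that are zero from \<open>n\<close> on;
    \<open>vec n\<close> recovers the vector.\<close>
  define S where "S = {f :: nat \<Rightarrow> complex. (\<forall>i\<ge>n. f i = 0) \<and> (\<Sum>i<n. (cmod (f i))\<^sup>2) = 1}"
  have "(\<Sum>i<n. (cmod (if i = 0 then 1 else 0))\<^sup>2) = (\<Sum>i<n. if i = 0 then 1 else 0 :: real)"
    by (rule sum.cong) auto
  then have "(\<lambda>i. if i = 0 then 1 else 0) \<in> S" using n by (auto simp: S_def)
  then have S: "compact S" "S \<noteq> {}" using compact_unit_sphere[of n] by (auto simp: S_def)
  have Sv: "vec n f \<in> carrier_vec n" "vec n f \<noteq> 0\<^sub>v n" if f: "f \<in> S" for f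
  proof -
    show "vec n f \<in> carrier_vec n" by simp
    show "vec n f \<noteq> 0\<^sub>v n"
    proof
      assume 0: "vec n f = 0\<^sub>v n"
      have "f i = 0" if "i < n" for i using arg_cong[OF 0, of "\<lambda>v. v $ i"] that by simp
      then show False using f by (simp add: S_def)
    qed
  qed
  define lm where "lm x = (- rform D x - sqrt (\<Delta> x)) / (2 * rform M x)" for x
  define lp where "lp x = (- rform D x + sqrt (\<Delta> x)) / (2 * rform M x)" for x
  note cont = continuous_on_rform[OF M(1), of S] continuous_on_rform[OF D(1), of S]
    continuous_on_rform[OF K(1), of S]
  have "\<forall>f\<in>S. 2 * rform M (vec n f) \<noteq> 0" using m[OF Sv] by fastforce
  then have lm_cont: "continuous_on S (\<lambda>f. lm (vec n f))" and lp_cont: "continuous_on S (\<lambda>f. lp (vec n f))"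
    unfolding lm_def lp_def \<Delta>_def using cont by (auto intro!: continuous_intros)
  obtain f where f: "f \<in> S" "\<And>h. h \<in> S \<Longrightarrow> lm (vec n h) \<le> lm (vec n f)"
    using continuous_attains_sup[OF S lm_cont] by auto
  obtain g where g: "g \<in> S" "\<And>h. h \<in> S \<Longrightarrow> lp (vec n g) \<le> lp (vec n h)"
    using continuous_attains_inf[OF S lp_cont] by auto
  define \<alpha> where "\<alpha> = (lm (vec n f) + lp (vec n g)) / 2"
  have Hlm: "rform (H (lm x)) x = - sqrt (\<Delta> x)" and Hlp: "rform (H (lp x)) x = sqrt (\<Delta> x)"
    if "x \<in> carrier_vec n" "x \<noteq> 0\<^sub>v n" for x
    using m[OF that] by (simp_all add: Hx[OF that(1)] lm_def lp_def field_simps)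
  \<comment> \<open>The slope of \<open>a \<mapsto> rform (H a) x\<close> is twice
    \<open>rform M x\<close>, hence positive, so values of \<open>H\<close> order the points
    \<open>a\<close>.\<close>
  have mono: "a < b" if "x \<in> carrier_vec n" "x \<noteq> 0\<^sub>v n" "rform (H a) x < rform (H b) x" for a b x
    using that m[OF that(1,2)] by (simp add: Hx mult_less_cancel_right)
  \<comment> \<open>At the point \<open>lm (vec n f)\<close>, \<open>separated\<close> keeps the
    value of \<open>H\<close> at \<open>vec n g\<close> below the value reached at the larger root
    of \<open>vec n g\<close>; monotonicity then orders the two points.\<close>
  have "lm (vec n f) < lp (vec n g)"
    using mono[OF Sv[OF g(1)]] separated[OF Sv[OF f(1)] Hlm[OF Sv[OF f(1)]] Sv[OF g(1)]] Hlp[OF Sv[OF g(1)]]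
    by simp
  then have \<alpha>: "lm (vec n h) < \<alpha>" "\<alpha> < lp (vec n h)" if "h \<in> S" for h
    using f(2)[OF that] g(2)[OF that] by (simp_all add: \<alpha>_def)
  have sphere: "rform (Q \<alpha>) (vec n h) < 0" if h: "h \<in> S" for h
  proof -
    let ?x = "vec n h"
    note x = Sv[OF h]
    have "rform (H (lm ?x)) ?x < rform (H \<alpha>) ?x" "rform (H \<alpha>) ?x < rform (H (lp ?x)) ?x"
      using \<alpha>[OF h] m[OF x] by (simp_all add: Hx)
    then have "\<bar>rform (H \<alpha>) ?x\<bar> < sqrt (\<Delta> ?x)" using Hlm[OF x] Hlp[OF x] by linarith
    then have "(rform (H \<alpha>) ?x)\<^sup>2 < \<Delta> ?x"
      using real_less_rsqrt sqrt_le_D by (metis linorder_not_less real_sqrt_abs real_sqrt_less_iff)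
    then show ?thesis using square[OF x(1), of \<alpha>] m[OF x] by (smt (verit) mult_nonneg_nonneg)
  qed
  show ?thesis
  proof (intro exI ballI impI)
    fix x :: "complex vec" assume x: "x \<in> carrier_vec n" "x \<noteq> 0\<^sub>v n"
    \<comment> \<open>The forms are homogeneous of degree two, so negativity on the sphere extends
      to every nonzero vector after division by the norm \<open>s\<close>.\<close>
    define s where "s = sqrt (\<Sum>i<n. (cmod (x $ i))\<^sup>2)"
    from x obtain k where k: "k < n" "x $ k \<noteq> 0" by (metis eq_vecI carrier_vecD index_zero_vec)
    have "0 < (\<Sum>i<n. (cmod (x $ i))\<^sup>2)" by (rule sum_pos2[of _ k]) (use k in auto)
    then have s: "0 < s" "s\<^sup>2 = (\<Sum>i<n. (cmod (x $ i))\<^sup>2)" by (simp_all add: s_def)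
    define h where "h i = (if i < n then x $ i / of_real s else 0)" for i
    have "(\<Sum>i<n. (cmod (h i))\<^sup>2) = (\<Sum>i<n. (cmod (x $ i))\<^sup>2 / s\<^sup>2)"
      using s by (intro sum.cong) (auto simp: h_def norm_divide power_divide)
    also have "\<dots> = 1" using s(1) by (simp add: s(2)[symmetric] flip: sum_divide_distrib)
    finally have "h \<in> S" by (simp add: S_def h_def)
    moreover have "x = of_real s \<cdot>\<^sub>v vec n h" using x s by (intro eq_vecI) (auto simp: h_def)
    then have "rform (Q \<alpha>) x = s\<^sup>2 * rform (Q \<alpha>) (vec n h)"
      using rform_smult_vec[OF Q(1), of "vec n h" \<alpha> "of_real s"] by simp
    ultimately have "rform (Q \<alpha>) x < 0" using sphere s(1) by (simp add: mult_pos_neg)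
    then show "\<alpha>\<^sup>2 * rform M x + \<alpha> * rform D x + rform K x < 0" using Qx[OF x(1)] by simp
  qed
qed

section \<open>Block matrices and the linearization\<close>

lemma qform_four_block:
  assumes "A \<in> carrier_mat n n" "B \<in> carrier_mat n m" "C \<in> carrier_mat m n" "D \<in> carrier_mat m m"
    and "x \<in> carrier_vec n" "y \<in> carrier_vec m"
  shows "qform (four_block_mat A B C D) (x @\<^sub>v y) =
    qform A x + conjugate x \<bullet> (B *\<^sub>v y) + (conjugate y \<bullet> (C *\<^sub>v x) + qform D y)"
proof -
  have conj: "conjugate (x @\<^sub>v y) = conjugate x @\<^sub>v conjugate y"
    using assms by (intro eq_vecI) auto
  have "qform (four_block_mat A B C D) (x @\<^sub>v y) =
      conjugate x \<bullet> (A *\<^sub>v x + B *\<^sub>v y) + conjugate y \<bullet> (C *\<^sub>v x + D *\<^sub>v y)"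
    unfolding qform_def conj four_block_mat_mult_vec[OF assms]
    using assms by (intro scalar_prod_append[of _ n _ m]) auto
  then show ?thesis
    using assms by (simp add: qform_def scalar_prod_add_distrib[of _ n] scalar_prod_add_distrib[of _ m])
qed

lemma hermitian_four_block_iff:
  assumes "A \<in> carrier_mat n n" "B \<in> carrier_mat n m" "C \<in> carrier_mat m n" "D \<in> carrier_mat m m"
  shows "hermitian_mat (four_block_mat A B C D) \<longleftrightarrow>
    hermitian_mat A \<and> hermitian_mat D \<and> mat_adjoint B = C \<and> mat_adjoint C = B"
proof -
  note adj = mat_adjoint_carrier[OF assms(1)] mat_adjoint_carrier[OF assms(2)]
    mat_adjoint_carrier[OF assms(3)] mat_adjoint_carrier[OF assms(4)]
  have "four_block_mat A1 B1 C1 D1 = four_block_mat A2 B2 C2 D2 \<longleftrightarrow>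
      A1 = A2 \<and> B1 = B2 \<and> C1 = C2 \<and> D1 = D2"
    if 1: "A1 \<in> carrier_mat n n" "B1 \<in> carrier_mat n m" "C1 \<in> carrier_mat m n" "D1 \<in> carrier_mat m m"
      and 2: "A2 \<in> carrier_mat n n" "B2 \<in> carrier_mat n m" "C2 \<in> carrier_mat m n" "D2 \<in> carrier_mat m m"
    for A1 A2 B1 B2 C1 C2 D1 D2 :: "complex mat"
  proof
    assume "four_block_mat A1 B1 C1 D1 = four_block_mat A2 B2 C2 D2"
    then have eq: "four_block_mat A1 B1 C1 D1 $$ (i, j) = four_block_mat A2 B2 C2 D2 $$ (i, j)" for i j
      by simp
    have "A1 $$ (i, j) = A2 $$ (i, j)" if "i < n" "j < n" for i j using eq[of i j] that 1 2 by simp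
    moreover have "B1 $$ (i, j) = B2 $$ (i, j)" if "i < n" "j < m" for i j
      using eq[of i "n + j"] that 1 2 by simp
    moreover have "C1 $$ (i, j) = C2 $$ (i, j)" if "i < m" "j < n" for i j
      using eq[of "n + i" j] that 1 2 by simp
    moreover have "D1 $$ (i, j) = D2 $$ (i, j)" if "i < m" "j < m" for i j
      using eq[of "n + i" "n + j"] that 1 2 by simp
    ultimately show "A1 = A2 \<and> B1 = B2 \<and> C1 = C2 \<and> D1 = D2"
      using 1 2 by (auto intro!: eq_matI)
  qed simp
  from this[OF adj(1,3,2,4) assms] show ?thesis
    unfolding hermitian_mat_def mat_adjoint_four_block[OF assms] by auto
qed

text \<open>Meant for S(\<mu>), whose lower right block is -\<mu> I: positive definiteness of that
  block is what forces \<mu> < 0.\<close>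

lemma pos_def_four_block_lower:
  assumes "A \<in> carrier_mat n n" "B \<in> carrier_mat n m" "C \<in> carrier_mat m n" "D \<in> carrier_mat m m"
    and pd: "pos_def_mat (four_block_mat A B C D)"
  shows "pos_def_mat D"
  unfolding pos_def_mat_def
proof (intro conjI ballI impI)
  show "hermitian_mat D" using pd hermitian_four_block_iff[OF assms(1-4)] by (simp add: pos_def_mat_def)
  fix y :: "complex vec" assume "y \<in> carrier_vec (dim_row D)" "y \<noteq> 0\<^sub>v (dim_row D)"
  then have y: "y \<in> carrier_vec m" "y \<noteq> 0\<^sub>v m" using assms by auto
  have "0\<^sub>v n @\<^sub>v y \<in> carrier_vec (n + m)" using y by simp
  moreover have "0\<^sub>v n @\<^sub>v y \<noteq> 0\<^sub>v (n + m)"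
  proof
    assume 0: "0\<^sub>v n @\<^sub>v y = 0\<^sub>v (n + m)"
    have "y $ i = 0" if "i < m" for i
      using arg_cong[OF 0, of "\<lambda>v. v $ (n + i)"] that y by simp
    then show False using y by (auto intro: eq_vecI)
  qed
  ultimately have "0 < qform (four_block_mat A B C D) (0\<^sub>v n @\<^sub>v y)"
    using pd assms by (simp add: pos_def_mat_def)
  also have "qform (four_block_mat A B C D) (0\<^sub>v n @\<^sub>v y) = qform D y"
  proof -
    have "A *\<^sub>v 0\<^sub>v n = 0\<^sub>v n" "C *\<^sub>v 0\<^sub>v n = 0\<^sub>v m"
      using assms by (auto simp: mult_mat_vec_def scalar_prod_def)
    then show ?thesis
      unfolding qform_four_block[OF assms(1-4) zero_carrier_vec y(1)] using assms y by (simp add: qform_def)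
  qed
  finally show "0 < qform D y" .
qed

lemma pos_def_four_block_diag_iff:
  assumes "A \<in> carrier_mat n n" "D \<in> carrier_mat m m"
  shows "pos_def_mat (four_block_mat A (0\<^sub>m n m) (0\<^sub>m m n) D) \<longleftrightarrow> pos_def_mat A \<and> pos_def_mat D"
    (is "pos_def_mat ?F \<longleftrightarrow> _")
proof -
  have q: "qform ?F (x @\<^sub>v y) = qform A x + qform D y" if "x \<in> carrier_vec n" "y \<in> carrier_vec m" for x y
  proof -
    have "0\<^sub>m n m *\<^sub>v y = 0\<^sub>v n" "0\<^sub>m m n *\<^sub>v x = 0\<^sub>v m"
      using that by (auto intro!: eq_vecI)
    then show ?thesis
      using qform_four_block[OF assms(1) zero_carrier_mat zero_carrier_mat assms(2) that] that by simp
  qed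
  have herm: "hermitian_mat ?F \<longleftrightarrow> hermitian_mat A \<and> hermitian_mat D"
    using hermitian_four_block_iff[OF assms(1) zero_carrier_mat zero_carrier_mat assms(2)] by simp
  have q0: "qform N (0\<^sub>v k) = 0" if "N \<in> carrier_mat k k" for N k
    using that by (simp add: qform_def scalar_prod_def)
  have 0: "0\<^sub>v (n + m) = 0\<^sub>v n @\<^sub>v 0\<^sub>v m" by (rule eq_vecI) auto
  have app: "x @\<^sub>v y = 0\<^sub>v (n + m) \<longleftrightarrow> x = 0\<^sub>v n \<and> y = 0\<^sub>v m"
    if "x \<in> carrier_vec n" "y \<in> carrier_vec m" for x y :: "complex vec"
    unfolding 0 by (rule append_vec_eq[OF that(1) zero_carrier_vec])
  have dim: "dim_row ?F = n + m" "dim_row A = n" "dim_row D = m" using assms by auto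
  show ?thesis
  proof
    assume pd: "pos_def_mat ?F"
    have pos: "0 < qform A x + qform D y"
      if "x \<in> carrier_vec n" "y \<in> carrier_vec m" "x \<noteq> 0\<^sub>v n \<or> y \<noteq> 0\<^sub>v m" for x y
      using pd that q[OF that(1,2)] app[OF that(1,2)] unfolding pos_def_mat_def dim by auto
    show "pos_def_mat A \<and> pos_def_mat D"
      using pd herm pos[of _ "0\<^sub>v m"] pos[of "0\<^sub>v n"] q0[OF assms(1)] q0[OF assms(2)]
      unfolding pos_def_mat_def dim by auto
  next
    assume pd: "pos_def_mat A \<and> pos_def_mat D"
    have nonneg: "0 \<le> qform N x" if "pos_def_mat N" "N \<in> carrier_mat k k" "x \<in> carrier_vec k" for N k x
      using that q0[of N k] by (cases "x = 0\<^sub>v k") (auto simp: pos_def_mat_def intro: less_imp_le)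
    show "pos_def_mat ?F"
      unfolding pos_def_mat_def dim all_vec_append
    proof (intro conjI ballI impI)
      fix x y :: "complex vec"
      assume xy: "x \<in> carrier_vec n" "y \<in> carrier_vec m" "x @\<^sub>v y \<noteq> 0\<^sub>v (n + m)"
      then consider "x \<noteq> 0\<^sub>v n" | "y \<noteq> 0\<^sub>v m" using app by auto
      then show "0 < qform ?F (x @\<^sub>v y)"
      proof cases
        case 1
        then have "0 < qform A x" using pd xy dim by (auto simp: pos_def_mat_def)
        then show ?thesis using nonneg[of D m y] pd assms xy by (simp add: q add_pos_nonneg)
      next
        case 2
        then have "0 < qform D y" using pd xy dim by (auto simp: pos_def_mat_def)
        then show ?thesis using nonneg[of A n x] pd assms xy by (simp add: q add_nonneg_pos)
      qed
    qed (use pd herm in \<open>simp add: pos_def_mat_def\<close>)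
  qed
qed

lemma pos_def_smult:
  assumes "N \<in> carrier_mat n n" "pos_def_mat N" "0 < c"
  shows "pos_def_mat (complex_of_real c \<cdot>\<^sub>m N)"
proof -
  have "0 < complex_of_real c * z" if "0 < z" for z
    using that assms(3) by (simp add: less_complex_def)
  then show ?thesis
    using assms qform_smult_mat[OF assms(1)] by (auto simp: pos_def_mat_def hermitian_mat_def)
qed

text \<open>Block elimination by a unipotent congruence. The lower block is a positive multiple of
  the identity because \<mu> < 0, so it can be inverted explicitly and only the Schur complement
  decides.\<close>

lemma pos_def_schur_complement_iff:
  fixes \<mu> :: real
  assumes A: "A \<in> carrier_mat n n" and G: "G \<in> carrier_mat n r" and \<mu>: "\<mu> < 0"
  shows "pos_def_mat (four_block_mat A G (mat_adjoint G) (- (complex_of_real \<mu> \<cdot>\<^sub>m 1\<^sub>m r))) \<longleftrightarrow>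
    pos_def_mat (A + complex_of_real (1 / \<mu>) \<cdot>\<^sub>m (G * mat_adjoint G))"
proof -
  note G' = mat_adjoint_carrier[OF G]
  \<comment> \<open>The inverse of the lower block applied to \<open>mat_adjoint G\<close>, so that
    \<open>?b * Z\<close> restores the off-diagonal block.\<close>
  define Z where "Z = complex_of_real (- 1 / \<mu>) \<cdot>\<^sub>m mat_adjoint G"
  have Z: "Z \<in> carrier_mat r n" using G' by (simp add: Z_def)
  note Z' = mat_adjoint_carrier[OF Z]
  have adjZ: "mat_adjoint Z = complex_of_real (- 1 / \<mu>) \<cdot>\<^sub>m G" by (simp add: Z_def)
  let ?b = "- (complex_of_real \<mu> \<cdot>\<^sub>m 1\<^sub>m r)"
  let ?a = "A + complex_of_real (1 / \<mu>) \<cdot>\<^sub>m (G * mat_adjoint G)"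
  have a: "?a \<in> carrier_mat n n" using A G G' by simp
  have b: "?b \<in> carrier_mat r r" by simp
  define F where "F = four_block_mat ?a (0\<^sub>m n r) (0\<^sub>m r n) ?b"
  define X where "X = four_block_mat (1\<^sub>m n) (0\<^sub>m n r) Z (1\<^sub>m r)"
  define Y where "Y = four_block_mat (1\<^sub>m n) (0\<^sub>m n r) (- Z) (1\<^sub>m r)"
  have carr: "F \<in> carrier_mat (n + r) (n + r)" "X \<in> carrier_mat (n + r) (n + r)" "Y \<in> carrier_mat (n + r) (n + r)"
    unfolding F_def X_def Y_def using a b by (intro four_block_carrier_mat; simp)+
  have nZ: "- Z \<in> carrier_mat r n" using Z by simp
  have ZZ: "- Z + Z = 0\<^sub>m r n" using Z by (intro eq_matI) auto
  have "Y * X = four_block_mat (1\<^sub>m n * 1\<^sub>m n + 0\<^sub>m n r * Z) (1\<^sub>m n * 0\<^sub>m n r + 0\<^sub>m n r * 1\<^sub>m r)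
     (- Z * 1\<^sub>m n + 1\<^sub>m r * Z) (- Z * 0\<^sub>m n r + 1\<^sub>m r * 1\<^sub>m r)"
    unfolding X_def Y_def
    by (rule mult_four_block_mat[OF one_carrier_mat zero_carrier_mat nZ one_carrier_mat
          one_carrier_mat zero_carrier_mat Z one_carrier_mat])
  also have "\<dots> = four_block_mat (1\<^sub>m n) (0\<^sub>m n r) (0\<^sub>m r n) (1\<^sub>m r)"
    unfolding right_mult_one_mat[OF nZ] left_mult_one_mat[OF Z] ZZ left_mult_zero_mat[OF Z]
      right_mult_zero_mat[OF nZ] by (intro cong_four_block_mat) auto
  finally have YX: "Y * X = 1\<^sub>m (n + r)" by simp
  have adjX: "mat_adjoint X = four_block_mat (1\<^sub>m n) (mat_adjoint Z) (0\<^sub>m r n) (1\<^sub>m r)"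
    unfolding X_def using mat_adjoint_four_block[OF one_carrier_mat zero_carrier_mat Z one_carrier_mat]
    by simp
  have b_eq: "?b = complex_of_real (- \<mu>) \<cdot>\<^sub>m 1\<^sub>m r" by (rule eq_matI) auto
  have bG: "?b * Z = mat_adjoint G"
    unfolding b_eq mult_smult_assoc_mat[OF one_carrier_mat Z] left_mult_one_mat[OF Z]
    using \<mu> by (intro eq_matI) (auto simp: Z_def)
  have Gb: "mat_adjoint Z * ?b = G"
    unfolding b_eq mult_smult_distrib[OF Z' one_carrier_mat] right_mult_one_mat[OF Z']
    using \<mu> by (intro eq_matI) (auto simp: adjZ)
  have ZbZ: "mat_adjoint Z * mat_adjoint G = - (complex_of_real (1 / \<mu>) \<cdot>\<^sub>m (G * mat_adjoint G))"
    unfolding adjZ mult_smult_assoc_mat[OF G G'] by (rule eq_matI) (use G G' in auto)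
  have FX: "F * X = four_block_mat (?a * 1\<^sub>m n + 0\<^sub>m n r * Z) (?a * 0\<^sub>m n r + 0\<^sub>m n r * 1\<^sub>m r)
     (0\<^sub>m r n * 1\<^sub>m n + ?b * Z) (0\<^sub>m r n * 0\<^sub>m n r + ?b * 1\<^sub>m r)"
    unfolding X_def F_def by (rule mult_four_block_mat[OF a _ _ b]) (use Z in auto)
  also have "\<dots> = four_block_mat ?a (0\<^sub>m n r) (mat_adjoint G) ?b"
    unfolding bG right_mult_one_mat[OF a] right_mult_one_mat[OF b] right_mult_zero_mat[OF a]
    using Z a G' b by (intro cong_four_block_mat) auto
  finally have FX: "F * X = four_block_mat ?a (0\<^sub>m n r) (mat_adjoint G) ?b" .
  have "mat_adjoint X * F * X = mat_adjoint X * (F * X)"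
    by (rule assoc_mult_mat[OF mat_adjoint_carrier[OF carr(2)] carr(1,2)])
  also have "\<dots> = four_block_mat (1\<^sub>m n * ?a + mat_adjoint Z * mat_adjoint G) (1\<^sub>m n * 0\<^sub>m n r + mat_adjoint Z * ?b)
     (0\<^sub>m r n * ?a + 1\<^sub>m r * mat_adjoint G) (0\<^sub>m r n * 0\<^sub>m n r + 1\<^sub>m r * ?b)"
    unfolding FX adjX by (rule mult_four_block_mat[OF _ Z' _ _ a _ G' b]) auto
  also have "\<dots> = four_block_mat A G (mat_adjoint G) ?b"
    unfolding Gb ZbZ left_mult_one_mat[OF a] left_mult_one_mat[OF G'] left_mult_one_mat[OF b] left_mult_zero_mat[OF a]
    using A G G' by (intro cong_four_block_mat eq_matI) auto
  finally have XFX: "mat_adjoint X * F * X = four_block_mat A G (mat_adjoint G) ?b" .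
  have "?b = mat_diag r (\<lambda>_. complex_of_real (- \<mu>))" by (rule eq_matI) (auto simp: mat_diag_def)
  then have "pos_def_mat ?b" using \<mu> by (simp only: pos_def_diag_iff) (simp add: less_complex_def)
  then show ?thesis
    using pos_def_congruence_iff[OF carr YX] pos_def_four_block_diag_iff[OF a b] XFX by (simp add: F_def)
qed

lemma qform_mult_adjoint_nonneg:
  assumes "G \<in> carrier_mat n r" "x \<in> carrier_vec n"
  shows "0 \<le> qform (G * mat_adjoint G) x"
proof -
  note G' = mat_adjoint_carrier[OF assms(1)]
  have "qform (G * mat_adjoint G) x = qform (mat_adjoint (mat_adjoint G) * 1\<^sub>m r * mat_adjoint G) x"
    using right_mult_one_mat[OF assms(1)] by simp
  also have "\<dots> = qform (mat_diag r (\<lambda>_. 1)) (mat_adjoint G *\<^sub>v x)"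
    using qform_congruence[OF one_carrier_mat G' assms(2)] by simp
  also have "\<dots> = complex_of_real (\<Sum>i<r. (cmod ((mat_adjoint G *\<^sub>v x) $ i))\<^sup>2)"
    unfolding qform_diag[OF mult_mat_vec_carrier[OF G' assms(2)]] by simp
  also have "0 \<le> \<dots>" by (simp only: less_eq_complex_def Re_complex_of_real Im_complex_of_real) (simp add: sum_nonneg)
  finally show ?thesis .
qed

text \<open>A triangular matrix with positive diagonal has nonzero determinant. Only with
  invertibility established does \<open>mat_inv C\<close> denote a definite matrix.\<close>

lemma cholesky_inverse:
  assumes "C \<in> carrier_mat n n" "cholesky C M"
  shows "mat_inv C \<in> carrier_mat n n" "mat_inv C * C = 1\<^sub>m n" "C * mat_inv C = 1\<^sub>m n"
proof -
  have "det C = prod_list (diag_mat C)"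
    using assms by (intro det_lower_triangular[of n]) (auto simp: cholesky_def)
  also have "\<dots> \<noteq> 0"
    using assms by (auto simp: prod_list_zero_iff diag_mat_def cholesky_def less_complex_def)
  finally obtain B where B: "B \<in> carrier_mat n n" "C * B = 1\<^sub>m n"
    using det_non_zero_imp_unit[OF assms(1), of "()"] by (auto simp: Units_def ring_mat_simps)
  then have "mat_inv C = B" using mat_inv assms(1) by blast
  then show "mat_inv C \<in> carrier_mat n n" "mat_inv C * C = 1\<^sub>m n" "C * mat_inv C = 1\<^sub>m n"
    using B mat_mult_left_right_inverse[OF assms(1) B] by auto
qed

text \<open>Separation provides \<alpha>; the sign is forced because at a nonnegative point all
  three terms of the form are nonnegative, as one test vector already shows.\<close>

theorem hyperbolic_neg_pos_def:
  assumes M: "M \<in> carrier_mat n n" and D: "D \<in> carrier_mat n n" "pos_def_mat D"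
    and K: "K \<in> carrier_mat n n" "\<And>x. x \<in> carrier_vec n \<Longrightarrow> 0 \<le> qform K x"
    and hyp: "hyperbolic_quad M D K" and n: "0 < n"
  shows "\<exists>\<alpha><0. pos_def_mat (- quad_matpoly M D K (complex_of_real \<alpha>))"
proof -
  have pd: "pos_def_mat M" and herm: "hermitian_mat M" "hermitian_mat D" "hermitian_mat K"
    using hyp by (auto simp: hyperbolic_quad_def pos_def_mat_def)
  note real = qform_eq_rform[OF herm(1) M] qform_eq_rform[OF herm(2) D(1)] qform_eq_rform[OF herm(3) K(1)]
  have "0 < (rform D x)\<^sup>2 - 4 * rform M x * rform K x" if x: "x \<in> carrier_vec n" "x \<noteq> 0\<^sub>v n" for x
  proof -
    have "0 < (qform D x)\<^sup>2 - 4 * qform M x * qform K x"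
      using hyp x M by (auto simp: hyperbolic_quad_def)
    also have "\<dots> = complex_of_real ((rform D x)\<^sup>2 - 4 * rform M x * rform K x)"
      using real[OF x(1)] by simp
    finally show ?thesis by (simp only: less_complex_def Re_complex_of_real zero_complex.sel)
  qed
  from hyperbolic_separation[OF M pd D(1) herm(2) K(1) herm(3) this n] obtain \<alpha>
    where \<alpha>: "\<And>x. x \<in> carrier_vec n \<Longrightarrow> x \<noteq> 0\<^sub>v n \<Longrightarrow> \<alpha>\<^sup>2 * rform M x + \<alpha> * rform D x + rform K x < 0"
    by blast
  have "\<alpha> < 0"
  proof (rule ccontr)
    assume "\<not> \<alpha> < 0"
    define e where "e = (unit_vec n 0 :: complex vec)"
    have e: "e \<in> carrier_vec n" "e \<noteq> 0\<^sub>v n" using n by (auto simp: e_def)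
    have "0 < qform M e" "0 < qform D e" "0 \<le> qform K e"
      using pd D K(2)[OF e(1)] e M by (auto simp: pos_def_mat_def)
    then have "0 \<le> rform M e" "0 \<le> rform D e" "0 \<le> rform K e"
      by (auto simp: rform_def less_complex_def less_eq_complex_def)
    then have "0 \<le> \<alpha>\<^sup>2 * rform M e + \<alpha> * rform D e + rform K e"
      using \<open>\<not> \<alpha> < 0\<close> by (intro add_nonneg_nonneg mult_nonneg_nonneg) auto
    with \<alpha>[OF e] show False by simp
  qed
  moreover have "pos_def_mat (- quad_matpoly M D K (complex_of_real \<alpha>))"
  proof -
    let ?N = "- quad_matpoly M D K (complex_of_real \<alpha>)"
    have N_eq: "?N = complex_of_real (- (\<alpha>\<^sup>2)) \<cdot>\<^sub>m M + complex_of_real (- \<alpha>) \<cdot>\<^sub>m D + complex_of_real (- 1) \<cdot>\<^sub>m K"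
      unfolding quad_matpoly_def using M D K by (intro eq_matI) auto
    have N: "?N \<in> carrier_mat n n" unfolding N_eq using M D K by simp
    have N_herm: "hermitian_mat ?N"
      unfolding N_eq using M D K herm
      by (simp add: hermitian_mat_def mat_adjoint_add[of _ n n] del: of_real_minus of_real_power)
    have "0 < qform ?N x" if x: "x \<in> carrier_vec n" "x \<noteq> 0\<^sub>v n" for x
    proof -
      have "rform ?N x = - (\<alpha>\<^sup>2 * rform M x + \<alpha> * rform D x + rform K x)"
        unfolding N_eq using M D K x
        by (simp add: rform_add_mat[of _ n] rform_smult_mat[of _ n] del: of_real_minus of_real_power of_real_1)
      with \<alpha>[OF x] qform_eq_rform[OF N_herm N x(1)] show ?thesis by (simp add: less_complex_def)
    qed
    with N N_herm show ?thesis by (auto simp: pos_def_mat_def)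
  qed
  ultimately show ?thesis by blast
qed

text \<open>-P(\<mu>) is the Schur complement multiplied by the positive number -\<mu>, and positive
  scaling preserves definiteness in both directions.\<close>

lemma neg_quad_pos_def_iff:
  fixes \<mu> :: real
  assumes M: "M \<in> carrier_mat n n" and D: "D \<in> carrier_mat n n" and G: "G \<in> carrier_mat n r"
    and \<mu>: "\<mu> < 0"
  shows "pos_def_mat (four_block_mat (complex_of_real \<mu> \<cdot>\<^sub>m M + D) G (mat_adjoint G)
      (- (complex_of_real \<mu> \<cdot>\<^sub>m 1\<^sub>m r))) \<longleftrightarrow>
    pos_def_mat (- quad_matpoly M D (G * mat_adjoint G) (complex_of_real \<mu>))"
proof -
  note G' = mat_adjoint_carrier[OF G]
  let ?P = "quad_matpoly M D (G * mat_adjoint G) (complex_of_real \<mu>)"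
  let ?a = "complex_of_real \<mu> \<cdot>\<^sub>m M + D + complex_of_real (1 / \<mu>) \<cdot>\<^sub>m (G * mat_adjoint G)"
  note GG = mult_carrier_mat[OF G G']
  have a: "?a \<in> carrier_mat n n" using M D GG by simp
  have P: "- ?P \<in> carrier_mat n n" unfolding quad_matpoly_def using M D GG by simp
  have 1: "- ?P = complex_of_real (- \<mu>) \<cdot>\<^sub>m ?a"
    unfolding quad_matpoly_def
  proof (rule eq_matI)
    fix i j assume "i < dim_row (complex_of_real (- \<mu>) \<cdot>\<^sub>m ?a)" "j < dim_col (complex_of_real (- \<mu>) \<cdot>\<^sub>m ?a)"
    then have ij: "i < n" "j < n" using G by auto
    show "(- ((complex_of_real \<mu>)\<^sup>2 \<cdot>\<^sub>m M + complex_of_real \<mu> \<cdot>\<^sub>m D + G * mat_adjoint G)) $$ (i, j) =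
        (complex_of_real (- \<mu>) \<cdot>\<^sub>m ?a) $$ (i, j)"
      using ij M D G \<mu> by (simp add: field_simps power2_eq_square del: index_mult_mat(1))
  qed (use M D G in auto)
  have 2: "?a = complex_of_real (1 / (- \<mu>)) \<cdot>\<^sub>m (- ?P)"
    unfolding 1 using \<mu> by (intro eq_matI) auto
  have "pos_def_mat ?a \<longleftrightarrow> pos_def_mat (- ?P)"
    using pos_def_smult[OF a, of "- \<mu>"] pos_def_smult[OF P, of "1 / (- \<mu>)"] \<mu> 1 2 by auto
  then show ?thesis
    using pos_def_schur_complement_iff[OF _ G \<mu>, of "complex_of_real \<mu> \<cdot>\<^sub>m M + D"] M D by simp
qed

text \<open>The block diagonal of \<open>mat_adjoint C\<close> and the identity cancels the inverse
  factors: \<open>C * E = 1\<close> restores \<open>D\<close> and \<open>G\<close>, while the scalar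
  block \<open>z I\<close> turns into \<open>z \<cdot>\<^sub>m (C * mat_adjoint C)\<close>, the
  leading term of S(z).\<close>

lemma linearization_congruence:
  fixes C D E G :: "complex mat" and z :: complex
  assumes C: "C \<in> carrier_mat n n" and E: "E \<in> carrier_mat n n" and CE: "C * E = 1\<^sub>m n"
    and D: "D \<in> carrier_mat n n" and G: "G \<in> carrier_mat n r"
  shows "mat_adjoint (four_block_mat (mat_adjoint C) (0\<^sub>m n r) (0\<^sub>m r n) (1\<^sub>m r)) *
      four_block_mat (E * D * mat_adjoint E + z \<cdot>\<^sub>m 1\<^sub>m n) (E * G) (mat_adjoint (E * G)) (- (z \<cdot>\<^sub>m 1\<^sub>m r)) *
      four_block_mat (mat_adjoint C) (0\<^sub>m n r) (0\<^sub>m r n) (1\<^sub>m r) =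
    four_block_mat (z \<cdot>\<^sub>m (C * mat_adjoint C) + D) G (mat_adjoint G) (- (z \<cdot>\<^sub>m 1\<^sub>m r))"
proof -
  let ?X = "E * D * mat_adjoint E + z \<cdot>\<^sub>m 1\<^sub>m n" and ?b = "- (z \<cdot>\<^sub>m 1\<^sub>m r) :: complex mat"
  note C' = mat_adjoint_carrier[OF C] and E' = mat_adjoint_carrier[OF E] and G' = mat_adjoint_carrier[OF G]
  note EG = mult_carrier_mat[OF E G] note EG' = mat_adjoint_carrier[OF EG]
  have EDE: "E * D * mat_adjoint E \<in> carrier_mat n n" using E D E' by simp
  then have X: "?X \<in> carrier_mat n n" by simp
  have b: "?b \<in> carrier_mat r r" by simp
  have EC: "mat_adjoint E * mat_adjoint C = 1\<^sub>m n" using mat_adjoint_mult[OF C E] CE by simp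
  note assoc = assoc_mult_mat[of _ n n _ n _ n] mult_carrier_mat[of _ n n _ n]
  have CX: "C * ?X * mat_adjoint C = z \<cdot>\<^sub>m (C * mat_adjoint C) + D"
  proof -
    have "C * ?X = C * (E * D * mat_adjoint E) + z \<cdot>\<^sub>m C"
      unfolding mult_add_distrib_mat[OF C EDE smult_carrier_mat[OF one_carrier_mat]]
        mult_smult_distrib[OF C one_carrier_mat] right_mult_one_mat[OF C] ..
    also have "\<dots> * mat_adjoint C = C * (E * D * mat_adjoint E) * mat_adjoint C + z \<cdot>\<^sub>m (C * mat_adjoint C)"
      unfolding add_mult_distrib_mat[OF mult_carrier_mat[OF C EDE] smult_carrier_mat[OF C] C']
        mult_smult_assoc_mat[OF C C'] ..
    also have "C * (E * D * mat_adjoint E) * mat_adjoint C = (C * E) * D * (mat_adjoint E * mat_adjoint C)"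
      by (simp only: assoc C E D C' E')
    also have "\<dots> = D" unfolding CE EC left_mult_one_mat[OF D] right_mult_one_mat[OF D] ..
    finally show ?thesis using comm_add_mat[OF D smult_carrier_mat[OF mult_carrier_mat[OF C C']]] by simp
  qed
  have CEG: "C * (E * G) = G"
    using assoc_mult_mat[OF C E G] CE left_mult_one_mat[OF G] by simp
  then have EGC: "mat_adjoint (E * G) * mat_adjoint C = mat_adjoint G"
    using mat_adjoint_mult[OF C EG] by simp
  have T': "mat_adjoint (four_block_mat (mat_adjoint C) (0\<^sub>m n r) (0\<^sub>m r n) (1\<^sub>m r)) =
      four_block_mat C (0\<^sub>m n r) (0\<^sub>m r n) (1\<^sub>m r)"
    using mat_adjoint_four_block[OF C' zero_carrier_mat zero_carrier_mat one_carrier_mat] by simp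
  have "four_block_mat C (0\<^sub>m n r) (0\<^sub>m r n) (1\<^sub>m r) * four_block_mat ?X (E * G) (mat_adjoint (E * G)) ?b =
    four_block_mat (C * ?X + 0\<^sub>m n r * mat_adjoint (E * G)) (C * (E * G) + 0\<^sub>m n r * ?b)
      (0\<^sub>m r n * ?X + 1\<^sub>m r * mat_adjoint (E * G)) (0\<^sub>m r n * (E * G) + 1\<^sub>m r * ?b)"
    by (rule mult_four_block_mat[OF C zero_carrier_mat zero_carrier_mat one_carrier_mat X EG EG' b])
  also have "\<dots> = four_block_mat (C * ?X) G (mat_adjoint (E * G)) ?b"
    unfolding CEG left_mult_zero_mat[OF EG'] left_mult_zero_mat[OF b] left_mult_zero_mat[OF X]
      left_mult_zero_mat[OF EG] left_mult_one_mat[OF EG'] left_mult_one_mat[OF b]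
      right_add_zero_mat[OF mult_carrier_mat[OF C X]] right_add_zero_mat[OF G]
      left_add_zero_mat[OF EG'] left_add_zero_mat[OF b] ..
  also have "\<dots> * four_block_mat (mat_adjoint C) (0\<^sub>m n r) (0\<^sub>m r n) (1\<^sub>m r) =
    four_block_mat (C * ?X * mat_adjoint C + G * 0\<^sub>m r n) (C * ?X * 0\<^sub>m n r + G * 1\<^sub>m r)
      (mat_adjoint (E * G) * mat_adjoint C + ?b * 0\<^sub>m r n) (mat_adjoint (E * G) * 0\<^sub>m n r + ?b * 1\<^sub>m r)"
    by (rule mult_four_block_mat[OF mult_carrier_mat[OF C X] G EG' b C' zero_carrier_mat zero_carrier_mat one_carrier_mat])
  also have "\<dots> = four_block_mat (C * ?X * mat_adjoint C) G (mat_adjoint G) ?b"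
    unfolding EGC right_mult_zero_mat[OF G] right_mult_zero_mat[OF mult_carrier_mat[OF C X]]
      right_mult_zero_mat[OF EG'] right_mult_zero_mat[OF b] right_mult_one_mat[OF G] right_mult_one_mat[OF b]
      right_add_zero_mat[OF mult_carrier_mat[OF mult_carrier_mat[OF C X] C']] left_add_zero_mat[OF G]
      right_add_zero_mat[OF G'] left_add_zero_mat[OF b] ..
  finally show ?thesis unfolding T' CX .
qed

text \<open>Written as a diagonal matrix, J can be fed into Sylvester's law; its sign counts are the
  origin of the multiplicities \<open>n\<close> and \<open>r\<close>.\<close>

lemma signature_matrix:
  defines "f \<equiv> \<lambda>n i. if i < (n :: nat) then - 1 else 1 :: real"
  assumes J: "J = four_block_mat (- 1\<^sub>m n) (0\<^sub>m n r) (0\<^sub>m r n) (1\<^sub>m r)"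
  shows "J = mat_diag (n + r) (\<lambda>i. complex_of_real (f n i))"
    and "hermitian_mat J" and "J * J = 1\<^sub>m (n + r)"
    and "card {i\<in>{..<n + r}. 0 < f n i} = r" and "card {i\<in>{..<n + r}. f n i < 0} = n"
proof -
  show J': "J = mat_diag (n + r) (\<lambda>i. complex_of_real (f n i))"
    unfolding J f_def by (rule eq_matI) (auto simp: mat_diag_def)
  show "hermitian_mat J" by (simp add: J' hermitian_mat_def)
  have "(\<lambda>i. complex_of_real (f n i) * complex_of_real (f n i)) = (\<lambda>_. 1)" by (auto simp: f_def)
  then show "J * J = 1\<^sub>m (n + r)" by (simp add: J')
  have "{i\<in>{..<n + r}. 0 < f n i} = {n..<n + r}" "{i\<in>{..<n + r}. f n i < 0} = {..<n}"
    by (auto simp: f_def)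
  then show "card {i\<in>{..<n + r}. 0 < f n i} = r" "card {i\<in>{..<n + r}. f n i < 0} = n"
    by simp_all
qed

text \<open>Multiplication by J flips the sign of the first block row, which removes the minus signs
  in the linearization and makes the pencil visibly Hermitian when \<open>X\<close> is Hermitian,
  \<open>C\<close> is the adjoint of \<open>B\<close> and \<open>z\<close> is real.\<close>

lemma signature_pencil:
  fixes X B C :: "complex mat"
  assumes "X \<in> carrier_mat n n" "B \<in> carrier_mat n r" "C \<in> carrier_mat r n"
    and J: "J = four_block_mat (- 1\<^sub>m n) (0\<^sub>m n r) (0\<^sub>m r n) (1\<^sub>m r)"
  shows "J * four_block_mat (- X) (- B) C (0\<^sub>m r r) - z \<cdot>\<^sub>m J =
    four_block_mat (X + z \<cdot>\<^sub>m 1\<^sub>m n) B C (- (z \<cdot>\<^sub>m 1\<^sub>m r))"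
proof -
  have F: "four_block_mat (- X) (- B) C (0\<^sub>m r r) \<in> carrier_mat (n + r) (n + r)"
    using assms by (intro four_block_carrier_mat) auto
  have JF: "J * four_block_mat (- X) (- B) C (0\<^sub>m r r) = four_block_mat X B C (0\<^sub>m r r)"
    unfolding signature_matrix(1)[OF J] mat_diag_mult_left[OF F]
    using assms(1-3) by (intro eq_matI) auto
  show ?thesis unfolding JF unfolding J using assms(1-3) by (intro eq_matI) auto
qed

section \<open>Eigenvalue counts and inertia of the pencil\<close>

context definitizable
begin

text \<open>\<open>W\<close> carries J by congruence to the diagonal with entries
  \<open>1 / (\<theta> i - \<alpha>)\<close>, whose signs tell the side of \<alpha>. Inertia is
  preserved, so the counts are those of J.\<close>

lemma card_sign:
  assumes "N = n + r" and J_eq: "J = four_block_mat (- 1\<^sub>m n) (0\<^sub>m n r) (0\<^sub>m r n) (1\<^sub>m r)"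
  shows "card {i\<in>{..<N}. \<alpha> < \<theta> i} = r" "card {i\<in>{..<N}. \<theta> i < \<alpha>} = n"
proof -
  note sig = signature_matrix[OF J_eq]
  note syl = sylvester_inertia_diag[OF W V WV, of "\<lambda>i. if i < n then - 1 else 1" "\<lambda>i. 1 / (\<theta> i - \<alpha>)"]
  have "{i\<in>{..<N}. \<alpha> < \<theta> i} = {i\<in>{..<N}. 0 < 1 / (\<theta> i - \<alpha>)}"
    "{i\<in>{..<N}. \<theta> i < \<alpha>} = {i\<in>{..<N}. 1 / (\<theta> i - \<alpha>) < 0}"
    by (auto simp: zero_less_divide_iff divide_less_0_iff)
  then show "card {i\<in>{..<N}. \<alpha> < \<theta> i} = r" "card {i\<in>{..<N}. \<theta> i < \<alpha>} = n"
    using syl sig WJW assms(1) by simp_all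
qed

lemma spectrum_eq:
  "spectrum A = complex_of_real ` (J_negative_eigenvalues J A \<union> J_positive_eigenvalues J A)"
proof -
  have "x \<in> J_negative_eigenvalues J A \<union> J_positive_eigenvalues J A \<longleftrightarrow> x \<in> \<theta> ` {..<N}" for x
    unfolding J_eigenvalues using \<theta> by force
  then have "J_negative_eigenvalues J A \<union> J_positive_eigenvalues J A = \<theta> ` {..<N}" by blast
  then show ?thesis
    by (auto simp: spectrum_def eigenvalue_similar_diag[OF A_carrier similar_A])
qed

lemma finite_J_eigenvalues: "finite (J_positive_eigenvalues J A)" "finite (J_negative_eigenvalues J A)"
  unfolding J_eigenvalues by simp_all

lemma count_J_eigenvalues:
  "count_mult A {x\<in>J_positive_eigenvalues J A. Q x} = card {i\<in>{..<N}. \<alpha> < \<theta> i \<and> Q (\<theta> i)}"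
  "count_mult A {x\<in>J_negative_eigenvalues J A. Q x} = card {i\<in>{..<N}. \<theta> i < \<alpha> \<and> Q (\<theta> i)}"
  using count_eigenvalues[of "\<lambda>x. \<alpha> < x \<and> Q x"] count_eigenvalues[of "\<lambda>x. x < \<alpha> \<and> Q x"]
  by (simp_all add: J_eigenvalues conj_assoc)

text \<open>Each \<open>\<theta> i\<close> lies on the same side of \<mu> as of \<alpha>, whichever
  of the two is larger, so numerator and denominator of every diagonal entry agree in sign.\<close>

lemma pencil_pos_def_between:
  assumes "\<And>x. x \<in> J_negative_eigenvalues J A \<Longrightarrow> x < \<mu>" "\<And>x. x \<in> J_positive_eigenvalues J A \<Longrightarrow> \<mu> < x"
  shows "pos_def_mat (J * A - complex_of_real \<mu> \<cdot>\<^sub>m J)"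
  unfolding pencil_pos_def_iff
proof safe
  fix i assume i: "i < N"
  with \<theta> consider "\<alpha> < \<theta> i" | "\<theta> i < \<alpha>" by force
  then show "0 < (\<theta> i - \<mu>) / (\<theta> i - \<alpha>)"
    using assms[of "\<theta> i"] i by cases (auto simp: J_eigenvalues zero_less_divide_iff)
qed

text \<open>For \<alpha> < \<mu> a diagonal entry is negative exactly when its \<theta> lies
  strictly between \<alpha> and \<mu>. It is positive above \<mu> and also below \<alpha>, where
  both differences are negative; the latter gives the constant summand.\<close>

lemma pencil_inertia_above:
  assumes "\<alpha> < \<mu>"
  shows "pos_inertia (J * A - complex_of_real \<mu> \<cdot>\<^sub>m J) =
      count_mult A {x\<in>J_positive_eigenvalues J A. \<mu> < x} + card {i\<in>{..<N}. \<theta> i < \<alpha>}"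
    and "neg_inertia (J * A - complex_of_real \<mu> \<cdot>\<^sub>m J) =
      count_mult A {x\<in>J_positive_eigenvalues J A. x < \<mu>}"
proof -
  have "{i\<in>{..<N}. 0 < (\<theta> i - \<mu>) / (\<theta> i - \<alpha>)} =
      {i\<in>{..<N}. \<alpha> < \<theta> i \<and> \<mu> < \<theta> i} \<union> {i\<in>{..<N}. \<theta> i < \<alpha>}"
    using assms by (auto simp: zero_less_divide_iff)
  moreover have "card (\<dots>) = card {i\<in>{..<N}. \<alpha> < \<theta> i \<and> \<mu> < \<theta> i} + card {i\<in>{..<N}. \<theta> i < \<alpha>}"
    by (rule card_Un_disjoint) auto
  moreover have "{i\<in>{..<N}. (\<theta> i - \<mu>) / (\<theta> i - \<alpha>) < 0} = {i\<in>{..<N}. \<alpha> < \<theta> i \<and> \<theta> i < \<mu>}"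
    using assms by (auto simp: divide_less_0_iff)
  ultimately show "pos_inertia (J * A - complex_of_real \<mu> \<cdot>\<^sub>m J) =
      count_mult A {x\<in>J_positive_eigenvalues J A. \<mu> < x} + card {i\<in>{..<N}. \<theta> i < \<alpha>}"
    "neg_inertia (J * A - complex_of_real \<mu> \<cdot>\<^sub>m J) = count_mult A {x\<in>J_positive_eigenvalues J A. x < \<mu>}"
    by (simp_all only: pencil_inertia count_J_eigenvalues)
qed

text \<open>The mirror image: the negative entries now belong to the \<theta> strictly between \<mu>
  and \<alpha>, and everything above \<alpha> contributes the constant summand.\<close>

lemma pencil_inertia_below:
  assumes "\<mu> < \<alpha>"
  shows "pos_inertia (J * A - complex_of_real \<mu> \<cdot>\<^sub>m J) =
      count_mult A {x\<in>J_negative_eigenvalues J A. x < \<mu>} + card {i\<in>{..<N}. \<alpha> < \<theta> i}"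
    and "neg_inertia (J * A - complex_of_real \<mu> \<cdot>\<^sub>m J) =
      count_mult A {x\<in>J_negative_eigenvalues J A. \<mu> < x}"
proof -
  have "{i\<in>{..<N}. 0 < (\<theta> i - \<mu>) / (\<theta> i - \<alpha>)} =
      {i\<in>{..<N}. \<theta> i < \<alpha> \<and> \<theta> i < \<mu>} \<union> {i\<in>{..<N}. \<alpha> < \<theta> i}"
    using assms by (auto simp: zero_less_divide_iff)
  moreover have "card (\<dots>) = card {i\<in>{..<N}. \<theta> i < \<alpha> \<and> \<theta> i < \<mu>} + card {i\<in>{..<N}. \<alpha> < \<theta> i}"
    by (rule card_Un_disjoint) auto
  moreover have "{i\<in>{..<N}. (\<theta> i - \<mu>) / (\<theta> i - \<alpha>) < 0} = {i\<in>{..<N}. \<theta> i < \<alpha> \<and> \<mu> < \<theta> i}"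
    using assms by (auto simp: divide_less_0_iff)
  ultimately show "pos_inertia (J * A - complex_of_real \<mu> \<cdot>\<^sub>m J) =
      count_mult A {x\<in>J_negative_eigenvalues J A. x < \<mu>} + card {i\<in>{..<N}. \<alpha> < \<theta> i}"
    "neg_inertia (J * A - complex_of_real \<mu> \<cdot>\<^sub>m J) = count_mult A {x\<in>J_negative_eigenvalues J A. \<mu> < x}"
    by (simp_all only: pencil_inertia count_J_eigenvalues)
qed

end

theorem theorem25:
  fixes n r :: nat
    and M C D G A J :: "complex mat"
    and P S :: "complex \<Rightarrow> complex mat"
    and \<Lambda>p \<Lambda>n :: "real set"
    and lp_min ln_max :: real
  assumes M: "M \<in> carrier_mat n n" "pos_def_mat M"
    and C: "C \<in> carrier_mat n n" "cholesky C M"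
    and D: "D \<in> carrier_mat n n" "pos_def_mat D"
    and G: "G \<in> carrier_mat n r" "vec_space.rank n G = r" "r \<ge> 1"
    and P: "P = quad_matpoly M D (G * mat_adjoint G)"
    and hyp: "hyperbolic_quad M D (G * mat_adjoint G)"
    and A: "A = four_block_mat
                  (- (mat_inv C * D * mat_adjoint (mat_inv C))) (- (mat_inv C * G))
                  (mat_adjoint (mat_inv C * G))                 (0\<^sub>m r r)"
    and J: "J = four_block_mat (- 1\<^sub>m n) (0\<^sub>m n r) (0\<^sub>m r n) (1\<^sub>m r)"
    and S: "S = (\<lambda>z. four_block_mat (z \<cdot>\<^sub>m M + D)     G
                                    (mat_adjoint G) (- (z \<cdot>\<^sub>m 1\<^sub>m r)))"
    and \<Lambda>p: "\<Lambda>p = J_positive_eigenvalues J A"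
    and \<Lambda>n: "\<Lambda>n = J_negative_eigenvalues J A"
    and lp_min: "lp_min = Min \<Lambda>p"
    and ln_max: "ln_max = Max \<Lambda>n"
  shows
    "(spectrum A = complex_of_real ` (\<Lambda>n \<union> \<Lambda>p) \<and> finite \<Lambda>n \<and> finite \<Lambda>p \<and>
      count_mult A \<Lambda>n = n \<and> count_mult A \<Lambda>p = r) \<and>
     (\<exists>\<alpha>::real. Max \<Lambda>n < \<alpha> \<and> \<alpha> < Min \<Lambda>p) \<and>
     (\<forall>\<mu>::real. ln_max < \<mu> \<and> \<mu> < lp_min \<longrightarrow>
        pos_def_mat (J * A - complex_of_real \<mu> \<cdot>\<^sub>m J)) \<and>
     (\<forall>\<mu>::real. ln_max < \<mu> \<and> \<mu> < lp_min \<longrightarrow>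
        \<mu> < 0 \<and> pos_def_mat (S (complex_of_real \<mu>)) \<and> pos_def_mat (- P (complex_of_real \<mu>))) \<and>
     (\<forall>\<mu>::real. \<not> eigenvalue A (complex_of_real \<mu>) \<longrightarrow>
        (\<mu> > lp_min \<longrightarrow>
           pos_inertia (J * A - complex_of_real \<mu> \<cdot>\<^sub>m J) = count_mult A {x\<in>\<Lambda>p. x > \<mu>} + n \<and>
           neg_inertia (J * A - complex_of_real \<mu> \<cdot>\<^sub>m J) = count_mult A {x\<in>\<Lambda>p. x < \<mu>}) \<and>
        (\<mu> < ln_max \<longrightarrow>
           pos_inertia (J * A - complex_of_real \<mu> \<cdot>\<^sub>m J) = count_mult A {x\<in>\<Lambda>n. x < \<mu>} + r \<and>
           neg_inertia (J * A - complex_of_real \<mu> \<cdot>\<^sub>m J) = count_mult A {x\<in>\<Lambda>n. x > \<mu>}))"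
proof -
  note J_eq = J \<comment> \<open>the interpretation below hides the name \<open>J\<close>\<close>
  define E where "E = mat_inv C"
  note E = cholesky_inverse[OF C, folded E_def]
  note C' = mat_adjoint_carrier[OF C(1)] and E' = mat_adjoint_carrier[OF E(1)] and G' = mat_adjoint_carrier[OF G(1)]
  note EG = mult_carrier_mat[OF E(1) G(1)]
  have MC: "M = C * mat_adjoint C" using C(2) by (simp add: cholesky_def)
  \<comment> \<open>For \<open>n = 0\<close> the matrix \<open>G\<close> would be empty and its rank
    0, against \<open>r \<ge> 1\<close>.\<close>
  have n: "0 < n"
  proof (rule ccontr)
    assume "\<not> 0 < n"
    then have "G = 0\<^sub>m n r" using G(1) by (intro eq_matI) auto
    then show False using vec_space.rank_0I[of n r, where ?'a = complex] G by simp
  qed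
  have EDE: "E * D * mat_adjoint E \<in> carrier_mat n n" using E D E' by simp
  have A': "A = four_block_mat (- (E * D * mat_adjoint E)) (- (E * G)) (mat_adjoint (E * G)) (0\<^sub>m r r)"
    by (simp add: A E_def)
  have A_carrier: "A \<in> carrier_mat (n + r) (n + r)" unfolding A' using EDE by (intro four_block_carrier_mat) auto
  have J_carrier: "J \<in> carrier_mat (n + r) (n + r)" unfolding J by (intro four_block_carrier_mat) auto
  note sig = signature_matrix(2,3)[OF J]
  have pencil: "J * A - complex_of_real \<mu> \<cdot>\<^sub>m J = four_block_mat (E * D * mat_adjoint E + of_real \<mu> \<cdot>\<^sub>m 1\<^sub>m n)
      (E * G) (mat_adjoint (E * G)) (- (of_real \<mu> \<cdot>\<^sub>m 1\<^sub>m r))" for \<mu>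
    unfolding A' by (rule signature_pencil[OF EDE EG mat_adjoint_carrier[OF EG] J])
  \<comment> \<open>The congruence from the pencil to S(\<mu>), and its inverse. Neither depends on
    \<mu>, so definiteness transfers for all \<mu> together.\<close>
  define T where "T = four_block_mat (mat_adjoint C) (0\<^sub>m n r) (0\<^sub>m r n) (1\<^sub>m r)"
  define T' where "T' = four_block_mat (mat_adjoint E) (0\<^sub>m n r) (0\<^sub>m r n) (1\<^sub>m r)"
  have T: "T \<in> carrier_mat (n + r) (n + r)" "T' \<in> carrier_mat (n + r) (n + r)"
    unfolding T_def T'_def using C' E' by (intro four_block_carrier_mat; simp)+
  have "mat_adjoint E * mat_adjoint C = 1\<^sub>m n" using mat_adjoint_mult[OF C(1) E(1)] E(3) by simp
  then have T'T: "T' * T = 1\<^sub>m (n + r)"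
    unfolding T_def T'_def
    using mult_four_block_mat[OF E' zero_carrier_mat zero_carrier_mat one_carrier_mat
        C' zero_carrier_mat zero_carrier_mat one_carrier_mat, of r]
      right_mult_zero_mat[OF E'] left_mult_zero_mat[OF C'] by simp
  have H_carrier: "J * A - complex_of_real \<mu> \<cdot>\<^sub>m J \<in> carrier_mat (n + r) (n + r)" for \<mu>
    using A_carrier J_carrier by auto
  have "mat_adjoint T * (J * A - complex_of_real \<mu> \<cdot>\<^sub>m J) * T = S (of_real \<mu>)" for \<mu>
    unfolding pencil T_def S MC by (rule linearization_congruence[OF C(1) E(1,3) D(1) G(1)])
  then have pencil_S: "pos_def_mat (J * A - complex_of_real \<mu> \<cdot>\<^sub>m J) \<longleftrightarrow> pos_def_mat (S (of_real \<mu>))" for \<mu>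
    using pos_def_congruence_iff[OF H_carrier T T'T] by metis
  have S_P: "pos_def_mat (S (of_real \<mu>)) \<longleftrightarrow> pos_def_mat (- P (of_real \<mu>))" if "\<mu> < 0" for \<mu>
    unfolding S P by (rule neg_quad_pos_def_iff[OF M(1) D(1) G(1) that])
  \<comment> \<open>The block -\<mu> I has at least one diagonal entry because
    \<open>r \<ge> 1\<close>, and that entry must be positive.\<close>
  have S_neg: "\<mu> < 0" if "pos_def_mat (S (of_real \<mu>))" for \<mu>
  proof -
    have "pos_def_mat (- (complex_of_real \<mu> \<cdot>\<^sub>m 1\<^sub>m r))"
      using that unfolding S by (rule pos_def_four_block_lower[rotated -1]) (use M D G G' in auto)
    also have "- (complex_of_real \<mu> \<cdot>\<^sub>m 1\<^sub>m r) = mat_diag r (\<lambda>_. complex_of_real (- \<mu>))"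
      by (rule eq_matI) (auto simp: mat_diag_def)
    finally have "\<forall>i<r. 0 < complex_of_real (- \<mu>)" unfolding pos_def_diag_iff .
    then have "0 < complex_of_real (- \<mu>)" using G(3) by (simp add: Suc_le_eq) blast
    then show ?thesis by (simp add: less_complex_def)
  qed
  obtain \<alpha> where "\<alpha> < 0" "pos_def_mat (- P (of_real \<alpha>))"
    using hyperbolic_neg_pos_def[OF M(1) D mult_carrier_mat[OF G(1) G'] qform_mult_adjoint_nonneg[OF G(1)] hyp n]
    unfolding P by blast
  then have "pos_def_mat (J * A - complex_of_real \<alpha> \<cdot>\<^sub>m J)" using pencil_S S_P by blast
  from definitizable_diagonalization[OF A_carrier J_carrier sig this]
  obtain W V \<theta> where "definitizable (n + r) A J W V \<theta> \<alpha>" by blast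
  then interpret definitizable "n + r" A J W V \<theta> \<alpha> .
  note card = card_sign[OF refl J_eq]
  \<comment> \<open>Both kinds of eigenvalues occur since \<open>n\<close> and \<open>r\<close> are
    positive; only then are \<open>Min\<close> and \<open>Max\<close> members of their sets, hence
    on the proper side of \<alpha>.\<close>
  have "{i\<in>{..<n + r}. \<alpha> < \<theta> i} \<noteq> {}" "{i\<in>{..<n + r}. \<theta> i < \<alpha>} \<noteq> {}"
    using card n G(3) by (metis card.empty less_numeral_extra(3) not_one_le_zero)+
  then have ne: "\<Lambda>p \<noteq> {}" "\<Lambda>n \<noteq> {}" by (auto simp: \<Lambda>p \<Lambda>n J_eigenvalues)
  have fin: "finite \<Lambda>p" "finite \<Lambda>n" using finite_J_eigenvalues by (simp_all add: \<Lambda>p \<Lambda>n)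
  have "lp_min \<in> \<Lambda>p" "ln_max \<in> \<Lambda>n" using ne fin by (simp_all add: lp_min ln_max)
  then have \<alpha>: "ln_max < \<alpha>" "\<alpha> < lp_min" by (simp_all add: \<Lambda>p \<Lambda>n J_eigenvalues)
  have definite: "pos_def_mat (J * A - complex_of_real \<mu> \<cdot>\<^sub>m J)" if "ln_max < \<mu>" "\<mu> < lp_min" for \<mu>
  proof (rule pencil_pos_def_between)
    show "x < \<mu>" if "x \<in> J_negative_eigenvalues J A" for x
      using Max_ge[OF fin(2), of x] that \<open>ln_max < \<mu>\<close> by (simp add: ln_max \<Lambda>n)
    show "\<mu> < x" if "x \<in> J_positive_eigenvalues J A" for x
      using Min_le[OF fin(1), of x] that \<open>\<mu> < lp_min\<close> by (simp add: lp_min \<Lambda>p)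
  qed
  have count: "count_mult A \<Lambda>n = n" "count_mult A \<Lambda>p = r"
    using count_J_eigenvalues[of "\<lambda>_. True"] card by (simp_all add: \<Lambda>p \<Lambda>n)
  have above: "pos_inertia (J * A - complex_of_real \<mu> \<cdot>\<^sub>m J) = count_mult A {x\<in>\<Lambda>p. x > \<mu>} + n"
    "neg_inertia (J * A - complex_of_real \<mu> \<cdot>\<^sub>m J) = count_mult A {x\<in>\<Lambda>p. x < \<mu>}" if "lp_min < \<mu>" for \<mu>
    using pencil_inertia_above[of \<mu>] \<alpha> that card by (simp_all add: \<Lambda>p)
  have below: "pos_inertia (J * A - complex_of_real \<mu> \<cdot>\<^sub>m J) = count_mult A {x\<in>\<Lambda>n. x < \<mu>} + r"
    "neg_inertia (J * A - complex_of_real \<mu> \<cdot>\<^sub>m J) = count_mult A {x\<in>\<Lambda>n. x > \<mu>}" if "\<mu> < ln_max" for \<mu>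
    using pencil_inertia_below[of \<mu>] \<alpha> that card by (simp_all add: \<Lambda>n)
  have sign: "\<mu> < 0 \<and> pos_def_mat (S (of_real \<mu>)) \<and> pos_def_mat (- P (of_real \<mu>))"
    if "ln_max < \<mu>" "\<mu> < lp_min" for \<mu>
    using definite[OF that] pencil_S S_neg S_P by blast
  have "spectrum A = complex_of_real ` (\<Lambda>n \<union> \<Lambda>p)" using spectrum_eq by (simp only: \<Lambda>p \<Lambda>n)
  moreover have "\<exists>\<alpha>::real. Max \<Lambda>n < \<alpha> \<and> \<alpha> < Min \<Lambda>p" using \<alpha> by (auto simp: lp_min ln_max)
  ultimately show ?thesis
    using fin count definite sign above below by (intro conjI allI impI) auto
qed

end
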